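(* Let $f$ and $g$ be two admissible free holomorphic functions and let ${\bf W}^{(f)}=(W_1^{(f)},\ldots,W_n^{(f)})$ and ${\bf W}^{(g)}=(W_1^{(g)},\ldots,W_n^{(g)})$ be the associated universal models. Assume that $\mathcal D_{g^{-1}}$ is a regular domain and $\mathcal D^{pure}_{f^{-1}}\subset\mathcal D^{pure}_{g^{-1}}$. Then the Beurling-Lax-Halmos type representation of the joint invariant subspaces under $W_1^{(f)}\otimes I_{\mathcal K},\ldots,W_n^{(f)}\otimes I_{\mathcal K}$ is essentially unique. More precisely, if $$\Psi_1(F^2(H_n)\otimes\mathcal E_1)=\Psi_2(F^2(H_n)\otimes\mathcal E_2),$$ where $\Psi_j:F^2(H_n)\otimes\mathcal E_j\to F^2(H_n)\otimes\mathcal K$, $j=1,2$, are partially isometric multi-analytic operators (i.e. partial isometries with $\Psi_j(W_i^{(g)}\otimes I_{\mathcal E_j})=(W_i^{(f)}\otimes I_{\mathcal K})\Psi_j$ for all $i\in\{1,\ldots,n\}$), then there is a partial isometry $V:\mathcal E_1\to\mathcal E_2$ such that $\Psi_1=\Psi_2(I\otimes V)$. In particular, $\Psi_1|_{\mathrm{supp}\,\Psi_1}$ coincides with $\Psi_2|_{\mathrm{supp}\,\Psi_2}$.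
   Context: Fix an integer $n\ge 1$ and an $n$-dimensional complex Hilbert space $H_n$ with orthonormal basis $e_1,\ldots,e_n$. The full Fock space is $F^2(H_n)=\bigoplus_{k\ge0}H_n^{\otimes k}$, $H_n^{\otimes 0}=\mathbb C1$; left creation operators: $S_i\varphi=e_i\otimes\varphi$. $\mathbb F_n^+$ is the unital free semigroup on generators $g_1,\ldots,g_n$ with identity $g_0$; $|\alpha|$ is the length of $\alpha$. For $\alpha=g_{i_1}\cdots g_{i_k}$ put $e_\alpha=e_{i_1}\otimes\cdots\otimes e_{i_k}$, $e_{g_0}=1$, and for operators or indeterminates $X_\alpha=X_{i_1}\cdots X_{i_k}$, $X_{g_0}=I$. A formal power series $g=1+\sum_{|\alpha|\ge1}b_\alpha Z_\alpha$ in noncommuting indeterminates is an admissible free holomorphic function if: (a) $b_\alpha>0$, $b_{g_0}=1$, $\sup_{\alpha}\frac{b_\alpha}{b_{g_i\alpha}}<\infty$ for each $i$; (b) $\limsup_{k}(\sum_{|\alpha|=k}b_\alpha^2)^{1/2k}<\infty$; (c) $\sup_{k}\|\sum_{p=0}^k\sum_{|\alpha|=p}a_\alpha W_\alpha W_\alpha^*\|<\infty$, where $g^{-1}=1+\sum_{|\alpha|\ge1}a_\alpha Z_\alpha$ is the formal power series inverse and ${\bf W}^{(g)}=(W_1,\ldots,W_n)$, the universal model of $g$, is given by $W_i=S_iD_i$, $D_ie_\alpha=\sqrt{b_\alpha/b_{g_i\alpha}}\,e_\alpha$. For a Hilbert space $\mathcal H$, $\mathcal D_{g^{-1}}(\mathcal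 H)$ is the set of $X=(X_1,\ldots,X_n)\in B(\mathcal H)^n$ such that (i) $\Delta_{g^{-1}}(X,X^* ):=\sum_{p=0}^\infty\sum_{|\alpha|=p}a_\alpha X_\alpha X_\alpha^*$ converges in the weak operator topology (WOT) and is $\ge0$; (ii) $\sum_{\alpha}b_\alpha X_\alpha\Delta_{g^{-1}}(X,X^* )X_\alpha^*\le I$ (WOT convergence). $X$ is pure if equality holds in (ii); $\mathcal D^{pure}_{g^{-1}}(\mathcal H)$ is the set of pure elements. $\mathcal D^{pure}_{f^{-1}}\subset\mathcal D^{pure}_{g^{-1}}$ means the inclusion holds over every Hilbert space $\mathcal H$. $\mathcal D_{g^{-1}}$ is a regular domain if $a_\alpha\le0$ for all $|\alpha|\ge1$ and $a_{g_i}<0$ for all $i$. The support $\mathrm{supp}\,\Psi$ of a multi-analytic operator $\Psi:F^2(H_n)\otimes\mathcal E\to F^2(H_n)\otimes\mathcal K$ is the smallest subspace of $F^2(H_n)\otimes\mathcal E$ reducing for all $W_i^{(g)}\otimes I_{\mathcal E}$ and containing $\overline{\mathrm{range}\,\Psi^*}$; it has the form $F^2(H_n)\otimes\mathcal G$ with $\mathcal G\subset\mathcal E$ a closed subspace. Two multi-analytic operators $A_j$ on $F^2(H_n)\otimes\mathcal G_j$, $j=1,2$, coincide if $A_1=A_2(I_{F^2(H_n)}\otimes\tau)$ for some unitary $\tau:\mathcal G_1\to\mathcal G_2$. *)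

theory Defs
  imports "HOL-Analysis.Analysis" "HOL-Library.Infinite_Typeclass"
begin

section \<open>Complex Hilbert spaces\<close>

text \<open>The inner product is linear in its first argument.\<close>

class chilbert_space = banach +
  fixes scaleC :: "complex \<Rightarrow> 'a \<Rightarrow> 'a" (infixr "*\<^sub>C" 75)
    and cinner :: "'a \<Rightarrow> 'a \<Rightarrow> complex"
  assumes scaleC_add_right: "c *\<^sub>C (x + y) = c *\<^sub>C x + c *\<^sub>C y"
    and scaleC_add_left: "(c + d) *\<^sub>C x = c *\<^sub>C x + d *\<^sub>C x"
    and scaleC_scaleC: "c *\<^sub>C d *\<^sub>C x = (c * d) *\<^sub>C x"
    and scaleR_scaleC: "r *\<^sub>R x = complex_of_real r *\<^sub>C x"
    and cinner_commute: "cinner x y = cnj (cinner y x)"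
    and cinner_add_left: "cinner (x + y) z = cinner x z + cinner y z"
    and cinner_scaleC_left: "cinner (c *\<^sub>C x) y = c * cinner x y"
    and cinner_self: "cinner x x = complex_of_real ((norm x)\<^sup>2)"

lemma norm_scaleC: "norm (c *\<^sub>C x) = cmod c * norm (x :: 'a::chilbert_space)"
proof -
  have "cinner (c *\<^sub>C x) (c *\<^sub>C x) = c * cinner x (c *\<^sub>C x)"
    by (rule cinner_scaleC_left)
  also have "cinner x (c *\<^sub>C x) = cnj c * cinner x x"
    by (metis cinner_commute cinner_scaleC_left complex_cnj_mult)
  finally have "complex_of_real ((norm (c *\<^sub>C x))\<^sup>2) = complex_of_real ((cmod c * norm x)\<^sup>2)"
    by (simp add: cinner_self power_mult_distrib complex_norm_square[of c] del: of_real_power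
        flip: of_real_power)
  then have "(norm (c *\<^sub>C x))\<^sup>2 = (cmod c * norm x)\<^sup>2"
    using of_real_eq_iff by blast
  then show ?thesis
    by (simp add: power2_eq_iff_nonneg)
qed

lemma Re_cinner_le: "Re (cinner x y) \<le> norm x * norm (y :: 'a::chilbert_space)"
proof -
  have "cinner (x + y) (x + y) = cinner x x + cinner y y + (cinner x y + cnj (cinner x y))"
    by (metis (no_types, opaque_lifting) add.assoc add.commute add.left_commute
        cinner_add_left cinner_commute complex_cnj_add)
  then have "(norm (x + y))\<^sup>2 = (norm x)\<^sup>2 + (norm y)\<^sup>2 + 2 * Re (cinner x y)"
    unfolding cinner_self by (simp add: complex_eq_iff)
  moreover have "(norm (x + y))\<^sup>2 \<le> (norm x + norm y)\<^sup>2"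
    by (simp add: norm_triangle_ineq power_mono)
  ultimately show ?thesis by (simp add: power2_sum)
qed

lemma cmod_cinner_le: "cmod (cinner x y) \<le> norm x * norm (y :: 'a::chilbert_space)"
proof (cases "cinner x y = 0")
  case False
  define c where "c = cnj (sgn (cinner x y))"
  have "c * cinner x y = complex_of_real (cmod (cinner x y))"
    using False by (simp add: c_def sgn_div_norm complex_norm_square[symmetric] scaleR_conv_of_real
        power2_eq_square field_simps flip: of_real_mult)
  then have "cmod (cinner x y) = Re (cinner (c *\<^sub>C x) y)"
    by (simp add: cinner_scaleC_left)
  also have "\<dots> \<le> norm (c *\<^sub>C x) * norm y" by (rule Re_cinner_le)
  also have "\<dots> = norm x * norm y"
    using False by (simp add: norm_scaleC c_def norm_sgn)
  finally show ?thesis .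
qed simp

instantiation complex :: chilbert_space
begin
definition scaleC_complex :: "complex \<Rightarrow> complex \<Rightarrow> complex" where "scaleC_complex c x = c * x"
definition cinner_complex :: "complex \<Rightarrow> complex \<Rightarrow> complex" where "cinner_complex x y = x * cnj y"
instance
  by standard (simp_all add: scaleC_complex_def cinner_complex_def algebra_simps
      scaleR_conv_of_real complex_norm_square del: of_real_power)
end

section \<open>Square-summable families\<close>

typedef (overloaded) ('i, 'e) l2 =
  "{h :: 'i \<Rightarrow> 'e::chilbert_space. (\<lambda>i. (norm (h i))\<^sup>2) summable_on UNIV}"
  by (rule exI[of _ "\<lambda>_. 0"]) simp

setup_lifting type_definition_l2

lemma l2_bound:
  fixes h :: "'i \<Rightarrow> 'e::chilbert_space"
  assumes "\<And>F. finite F \<Longrightarrow> L2_set (\<lambda>i. norm (h i)) F \<le> C"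
  shows "(\<lambda>i. (norm (h i))\<^sup>2) summable_on UNIV" "sqrt (\<Sum>\<^sub>\<infinity>i. (norm (h i))\<^sup>2) \<le> C"
proof -
  have C: "0 \<le> C" using assms[of "{}"] by simp
  have le: "(\<Sum>i\<in>F. (norm (h i))\<^sup>2) \<le> C\<^sup>2" if "finite F" for F
    using assms[OF that] C by (simp add: L2_set_def sqrt_le_D)
  show s: "(\<lambda>i. (norm (h i))\<^sup>2) summable_on UNIV"
    by (rule nonneg_bdd_above_summable_on) (auto intro!: bdd_aboveI[of _ "C\<^sup>2"] le)
  have "(\<Sum>\<^sub>\<infinity>i. (norm (h i))\<^sup>2) \<le> C\<^sup>2"
    by (rule infsum_le_finite_sums[OF s]) (use le in auto)
  then show "sqrt (\<Sum>\<^sub>\<infinity>i. (norm (h i))\<^sup>2) \<le> C"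
    using C real_le_lsqrt by presburger
qed

lemma l2_L2_set_le:
  fixes h :: "'i \<Rightarrow> 'e::chilbert_space"
  assumes "(\<lambda>i. (norm (h i))\<^sup>2) summable_on UNIV" "finite F"
  shows "L2_set (\<lambda>i. norm (h i)) F \<le> sqrt (\<Sum>\<^sub>\<infinity>i. (norm (h i))\<^sup>2)"
  unfolding L2_set_def by (rule real_sqrt_le_mono, rule finite_sum_le_infsum) (use assms in auto)

lemma l2_triangle:
  fixes h k :: "'i \<Rightarrow> 'e::chilbert_space"
  assumes h: "(\<lambda>i. (norm (h i))\<^sup>2) summable_on UNIV"
    and k: "(\<lambda>i. (norm (k i))\<^sup>2) summable_on UNIV"
  shows "(\<lambda>i. (norm (h i + k i))\<^sup>2) summable_on UNIV"
    "sqrt (\<Sum>\<^sub>\<infinity>i. (norm (h i + k i))\<^sup>2)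
      \<le> sqrt (\<Sum>\<^sub>\<infinity>i. (norm (h i))\<^sup>2) + sqrt (\<Sum>\<^sub>\<infinity>i. (norm (k i))\<^sup>2)"
proof -
  have *: "L2_set (\<lambda>i. norm (h i + k i)) F
      \<le> sqrt (\<Sum>\<^sub>\<infinity>i. (norm (h i))\<^sup>2) + sqrt (\<Sum>\<^sub>\<infinity>i. (norm (k i))\<^sup>2)"
    if F: "finite F" for F
  proof -
    have "L2_set (\<lambda>i. norm (h i + k i)) F \<le> L2_set (\<lambda>i. norm (h i) + norm (k i)) F"
      by (rule L2_set_mono) (auto intro: norm_triangle_ineq)
    also have "\<dots> \<le> L2_set (\<lambda>i. norm (h i)) F + L2_set (\<lambda>i. norm (k i)) F"
      by (rule L2_set_triangle_ineq)
    finally show ?thesis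
      using l2_L2_set_le[OF h F] l2_L2_set_le[OF k F] by linarith
  qed
  from l2_bound[OF *] show "(\<lambda>i. (norm (h i + k i))\<^sup>2) summable_on UNIV"
    "sqrt (\<Sum>\<^sub>\<infinity>i. (norm (h i + k i))\<^sup>2)
      \<le> sqrt (\<Sum>\<^sub>\<infinity>i. (norm (h i))\<^sup>2) + sqrt (\<Sum>\<^sub>\<infinity>i. (norm (k i))\<^sup>2)"
    by blast+
qed

lemma l2_scale:
  fixes h :: "'i \<Rightarrow> 'e::chilbert_space"
  assumes "(\<lambda>i. (norm (h i))\<^sup>2) summable_on UNIV"
  shows "(\<lambda>i. (norm (c *\<^sub>C h i))\<^sup>2) summable_on UNIV"
  using summable_on_cmult_right[OF assms, of "(cmod c)\<^sup>2"]
  by (simp add: norm_scaleC power_mult_distrib)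

lemma l2_cinner_summable:
  fixes h k :: "'i \<Rightarrow> 'e::chilbert_space"
  assumes h: "(\<lambda>i. (norm (h i))\<^sup>2) summable_on UNIV"
    and k: "(\<lambda>i. (norm (k i))\<^sup>2) summable_on UNIV"
  shows "(\<lambda>i. cinner (h i) (k i)) summable_on UNIV"
proof -
  have bound: "cmod (cinner (h i) (k i)) \<le> norm ((norm (h i))\<^sup>2 + (norm (k i))\<^sup>2)" for i
  proof -
    have "cmod (cinner (h i) (k i)) \<le> norm (h i) * norm (k i)" by (rule cmod_cinner_le)
    also have "\<dots> \<le> (norm (h i))\<^sup>2 + (norm (k i))\<^sup>2"
      using sum_squares_bound[of "norm (h i)" "norm (k i)"]
        mult_nonneg_nonneg[OF norm_ge_zero[of "h i"] norm_ge_zero[of "k i"]] by linarith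
    finally show ?thesis by simp
  qed
  have "(\<lambda>i. norm ((norm (h i))\<^sup>2 + (norm (k i))\<^sup>2)) summable_on UNIV"
    using summable_on_add[OF h k] by simp
  from Infinite_Sum.abs_summable_on_comparison_test[OF this, of "\<lambda>i. cinner (h i) (k i)"] bound
  show ?thesis by (blast intro: Infinite_Sum.abs_summable_summable)
qed

instantiation l2 :: (type, chilbert_space) real_normed_vector
begin

lift_definition zero_l2 :: "('a, 'b) l2" is "\<lambda>_. 0" by simp
lift_definition plus_l2 :: "('a, 'b) l2 \<Rightarrow> ('a, 'b) l2 \<Rightarrow> ('a, 'b) l2" is "\<lambda>h k i. h i + k i"
  by (rule l2_triangle)
lift_definition uminus_l2 :: "('a, 'b) l2 \<Rightarrow> ('a, 'b) l2" is "\<lambda>h i. - h i" by simp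
lift_definition minus_l2 :: "('a, 'b) l2 \<Rightarrow> ('a, 'b) l2 \<Rightarrow> ('a, 'b) l2" is "\<lambda>h k i. h i - k i"
  subgoal for h k using l2_triangle(1)[of h "\<lambda>i. - k i"] by simp
  done
lift_definition scaleR_l2 :: "real \<Rightarrow> ('a, 'b) l2 \<Rightarrow> ('a, 'b) l2" is "\<lambda>r h i. r *\<^sub>R h i"
  unfolding scaleR_scaleC by (rule l2_scale)
lift_definition norm_l2 :: "('a, 'b) l2 \<Rightarrow> real" is "\<lambda>h. sqrt (\<Sum>\<^sub>\<infinity>i. (norm (h i))\<^sup>2)" .
definition dist_l2 :: "('a, 'b) l2 \<Rightarrow> ('a, 'b) l2 \<Rightarrow> real" where "dist_l2 h k = norm (h - k)"
definition sgn_l2 :: "('a, 'b) l2 \<Rightarrow> ('a, 'b) l2" where "sgn_l2 h = inverse (norm h) *\<^sub>R h"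
definition uniformity_l2 :: "(('a, 'b) l2 \<times> ('a, 'b) l2) filter" where
  "uniformity_l2 = (INF e\<in>{0 <..}. principal {(x, y). dist x y < e})"
definition open_l2 :: "('a, 'b) l2 set \<Rightarrow> bool" where
  "open_l2 U \<longleftrightarrow> (\<forall>x\<in>U. \<forall>\<^sub>F (x', y) in uniformity. x' = x \<longrightarrow> y \<in> U)"

instance
proof
  fix x y z :: "('a, 'b) l2" and a b :: real and U :: "('a, 'b) l2 set"
  show "x + y + z = x + (y + z)" by transfer (simp add: add.assoc)
  show "x + y = y + x" by transfer (simp add: add.commute)
  show "0 + x = x" by transfer simp
  show "- x + x = 0" by transfer simp
  show "x - y = x + - y" by transfer simp
  show "a *\<^sub>R (x + y) = a *\<^sub>R x + a *\<^sub>R y" by transfer (simp add: scaleR_add_right)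
  show "(a + b) *\<^sub>R x = a *\<^sub>R x + b *\<^sub>R x" by transfer (simp add: scaleR_add_left)
  show "a *\<^sub>R b *\<^sub>R x = (a * b) *\<^sub>R x" by transfer simp
  show "1 *\<^sub>R x = x" by transfer simp
  show "dist x y = norm (x - y)" by (rule dist_l2_def)
  show "sgn x = inverse (norm x) *\<^sub>R x" by (rule sgn_l2_def)
  show "uniformity = (INF e\<in>{0 <..}. principal {(x, y :: ('a, 'b) l2). dist x y < e})"
    by (rule uniformity_l2_def)
  show "open U = (\<forall>x\<in>U. \<forall>\<^sub>F (x', y) in uniformity. x' = x \<longrightarrow> y \<in> U)" by (rule open_l2_def)
  show "(norm x = 0) = (x = 0)"
  proof transfer
    fix h :: "'a \<Rightarrow> 'b" assume h: "(\<lambda>i. (norm (h i))\<^sup>2) summable_on UNIV"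
    have "h i = 0" if "sqrt (\<Sum>\<^sub>\<infinity>i. (norm (h i))\<^sup>2) = 0" for i
      using l2_L2_set_le[OF h, of "{i}"] that by (simp add: L2_set_def)
    then show "(sqrt (\<Sum>\<^sub>\<infinity>i. (norm (h i))\<^sup>2) = 0) = (h = (\<lambda>_. 0))" by auto
  qed
  show "norm (x + y) \<le> norm x + norm y" by transfer (rule l2_triangle)
  show "norm (a *\<^sub>R x) = \<bar>a\<bar> * norm x"
    by transfer (simp add: power_mult_distrib infsum_cmult_right' real_sqrt_mult)
qed

end

instantiation l2 :: (type, chilbert_space) chilbert_space
begin

lift_definition scaleC_l2 :: "complex \<Rightarrow> ('a, 'b) l2 \<Rightarrow> ('a, 'b) l2" is "\<lambda>c h i. c *\<^sub>C h i"
  by (rule l2_scale)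
lift_definition cinner_l2 :: "('a, 'b) l2 \<Rightarrow> ('a, 'b) l2 \<Rightarrow> complex" is
  "\<lambda>h k. \<Sum>\<^sub>\<infinity>i. cinner (h i) (k i)" .

instance
proof
  fix X :: "nat \<Rightarrow> ('a, 'b) l2"
  assume X: "Cauchy X"
  have coord: "norm (Rep_l2 h i) \<le> norm h" for h :: "('a, 'b) l2" and i
    using l2_L2_set_le[of "Rep_l2 h" "{i}"] Rep_l2[of h] by (simp add: L2_set_def norm_l2.rep_eq)
  have diff: "Rep_l2 (h - k) i = Rep_l2 h i - Rep_l2 k i" for h k :: "('a, 'b) l2" and i
    by (simp add: minus_l2.rep_eq)
  have "Cauchy (\<lambda>n. Rep_l2 (X n) i)" for i
  proof (rule metric_CauchyI)
    fix e :: real assume "0 < e"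
    then obtain M where M: "\<And>m n. m \<ge> M \<Longrightarrow> n \<ge> M \<Longrightarrow> dist (X m) (X n) < e"
      using X by (meson Cauchy_def)
    show "\<exists>M. \<forall>m\<ge>M. \<forall>n\<ge>M. dist (Rep_l2 (X m) i) (Rep_l2 (X n) i) < e"
      using M coord[of "X m - X n" i for m n] by (metis diff dist_norm le_less_trans)
  qed
  then have "\<exists>l. (\<lambda>n. Rep_l2 (X n) i) \<longlonglongrightarrow> l" for i
    using Cauchy_convergent convergent_def by blast
  then obtain L where L: "\<And>i. (\<lambda>n. Rep_l2 (X n) i) \<longlonglongrightarrow> L i" by metis
  have key: "L2_set (\<lambda>i. norm (Rep_l2 (X m) i - L i)) F \<le> e"
    if M: "\<And>m n. m \<ge> M \<Longrightarrow> n \<ge> M \<Longrightarrow> norm (X m - X n) \<le> e" and m: "m \<ge> M" and F: "finite F"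
    for e M m F
  proof (rule LIMSEQ_le_const2)
    show "(\<lambda>n. L2_set (\<lambda>i. norm (Rep_l2 (X m) i - Rep_l2 (X n) i)) F)
        \<longlonglongrightarrow> L2_set (\<lambda>i. norm (Rep_l2 (X m) i - L i)) F"
      unfolding L2_set_def by (intro tendsto_intros L)
    have "L2_set (\<lambda>i. norm (Rep_l2 (X m) i - Rep_l2 (X n) i)) F \<le> e" if "n \<ge> M" for n
      using l2_L2_set_le[of "Rep_l2 (X m - X n)" F] Rep_l2[of "X m - X n"] F M[OF m that]
      by (simp add: norm_l2.rep_eq diff)
    then show "\<exists>N. \<forall>n\<ge>N. L2_set (\<lambda>i. norm (Rep_l2 (X m) i - Rep_l2 (X n) i)) F \<le> e" by blast
  qed
  have ex: "\<exists>M. \<forall>m n. m \<ge> M \<longrightarrow> n \<ge> M \<longrightarrow> norm (X m - X n) \<le> e" if "0 < e" for e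
    using X that by (metis Cauchy_def dist_norm less_eq_real_def)
  obtain M where M: "\<And>m n. m \<ge> M \<Longrightarrow> n \<ge> M \<Longrightarrow> norm (X m - X n) \<le> 1"
    using ex[of 1] by auto
  have "(\<lambda>i. (norm (Rep_l2 (X M) i - L i))\<^sup>2) summable_on UNIV"
    by (rule l2_bound(1)[of _ 1]) (rule key[OF M], auto)
  from l2_triangle(1)[OF _ this, of "\<lambda>i. - Rep_l2 (X M) i"] Rep_l2[of "X M"]
  have "(\<lambda>i. (norm (L i))\<^sup>2) summable_on UNIV" by simp
  then have RL: "Rep_l2 (Abs_l2 L) = L" by (simp add: Abs_l2_inverse)
  have "X \<longlonglongrightarrow> Abs_l2 L"
  proof (rule LIMSEQ_I)
    fix r :: real assume r: "0 < r"
    obtain M where M: "\<And>m n. m \<ge> M \<Longrightarrow> n \<ge> M \<Longrightarrow> norm (X m - X n) \<le> r / 2"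
      using ex[of "r / 2"] r by auto
    have "norm (X m - Abs_l2 L) \<le> r / 2" if "m \<ge> M" for m
      unfolding norm_l2.rep_eq diff RL
      by (rule l2_bound(2)) (rule key[OF M that], auto)
    then show "\<exists>no. \<forall>n\<ge>no. norm (X n - Abs_l2 L) < r"
      using r by (intro exI[of _ M]) fastforce
  qed
  then show "convergent X" by (auto simp: convergent_def)
next
  fix x y z :: "('a, 'b) l2" and c d :: complex and r :: real
  show "c *\<^sub>C (x + y) = c *\<^sub>C x + c *\<^sub>C y" by transfer (simp add: scaleC_add_right)
  show "(c + d) *\<^sub>C x = c *\<^sub>C x + d *\<^sub>C x" by transfer (simp add: scaleC_add_left)
  show "c *\<^sub>C d *\<^sub>C x = (c * d) *\<^sub>C x" by transfer (simp add: scaleC_scaleC)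
  show "r *\<^sub>R x = complex_of_real r *\<^sub>C x" by transfer (simp add: scaleR_scaleC)
  show "cinner x y = cnj (cinner y x)"
    by transfer (simp flip: infsum_cnj cinner_commute)
  show "cinner (x + y) z = cinner x z + cinner y z"
    by transfer (simp add: cinner_add_left infsum_add l2_cinner_summable)
  show "cinner (c *\<^sub>C x) y = c * cinner x y"
    by transfer (simp add: cinner_scaleC_left infsum_cmult_right')
  show "cinner x x = complex_of_real ((norm x)\<^sup>2)"
  proof transfer
    fix h :: "'a \<Rightarrow> 'b" assume h: "(\<lambda>i. (norm (h i))\<^sup>2) summable_on UNIV"
    have "0 \<le> (\<Sum>\<^sub>\<infinity>i. (norm (h i))\<^sup>2)" by (rule infsum_nonneg) simp
    moreover have "((\<lambda>i. complex_of_real ((norm (h i))\<^sup>2))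
        has_sum complex_of_real (\<Sum>\<^sub>\<infinity>i. (norm (h i))\<^sup>2)) UNIV"
      by (rule has_sum_of_real) (rule has_sum_infsum[OF h])
    ultimately show "(\<Sum>\<^sub>\<infinity>i. cinner (h i) (h i))
        = complex_of_real ((sqrt (\<Sum>\<^sub>\<infinity>i. (norm (h i))\<^sup>2))\<^sup>2)"
      by (simp add: cinner_self infsumI)
  qed
qed

end

section \<open>Operators on closed subspaces\<close>

definition closed_csubspace :: "'a::chilbert_space set \<Rightarrow> bool" where
  "closed_csubspace H \<longleftrightarrow> closed H \<and> 0 \<in> H \<and> (\<forall>x\<in>H. \<forall>y\<in>H. x + y \<in> H) \<and> (\<forall>c. \<forall>x\<in>H. c *\<^sub>C x \<in> H)"

text \<open>In the following, \<open>H\<close> and \<open>K\<close> are closed subspaces, seen as Hilbert spaces of their own.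
  An operator on \<open>H\<close> is a function on the surrounding type; its values outside \<open>H\<close> never matter.\<close>

definition bounded_op :: "'a::chilbert_space set \<Rightarrow> 'b::chilbert_space set \<Rightarrow> ('a \<Rightarrow> 'b) \<Rightarrow> bool" where
  "bounded_op H K T \<longleftrightarrow> T ` H \<subseteq> K
     \<and> (\<forall>x\<in>H. \<forall>y\<in>H. T (x + y) = T x + T y) \<and> (\<forall>c. \<forall>x\<in>H. T (c *\<^sub>C x) = c *\<^sub>C T x)
     \<and> (\<exists>C. \<forall>x\<in>H. norm (T x) \<le> C * norm x)"

definition adj :: "'a::chilbert_space set \<Rightarrow> ('a \<Rightarrow> 'b::chilbert_space) \<Rightarrow> 'b \<Rightarrow> 'a" where
  "adj H T y = (THE x. x \<in> H \<and> (\<forall>z\<in>H. cinner (T z) y = cinner z x))"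

definition positive_op :: "'a::chilbert_space set \<Rightarrow> ('a \<Rightarrow> 'a) \<Rightarrow> bool" where
  "positive_op H T \<longleftrightarrow> (\<forall>x\<in>H. cinner (T x) x \<in> \<real>\<^sub>\<ge>\<^sub>0)"

definition wot_tendsto ::
  "'a::chilbert_space set \<Rightarrow> ('j \<Rightarrow> 'a \<Rightarrow> 'a) \<Rightarrow> ('a \<Rightarrow> 'a) \<Rightarrow> 'j filter \<Rightarrow> bool" where
  "wot_tendsto H T L F \<longleftrightarrow>
     bounded_op H H L \<and> (\<forall>x\<in>H. \<forall>y\<in>H. ((\<lambda>j. cinner (T j x) y) \<longlongrightarrow> cinner (L x) y) F)"

definition partial_isometry :: "('a::chilbert_space \<Rightarrow> 'b::chilbert_space) \<Rightarrow> bool" where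
  "partial_isometry T \<longleftrightarrow> bounded_op UNIV UNIV T
     \<and> (\<forall>x. (\<forall>z. T z = 0 \<longrightarrow> cinner x z = 0) \<longrightarrow> norm (T x) = norm x)"

definition unitary_op :: "'a::chilbert_space set \<Rightarrow> 'b::chilbert_space set \<Rightarrow> ('a \<Rightarrow> 'b) \<Rightarrow> bool" where
  "unitary_op H K T \<longleftrightarrow> bounded_op H K T \<and> T ` H = K \<and> (\<forall>x\<in>H. norm (T x) = norm x)"

section \<open>Vector-valued full Fock spaces\<close>

text \<open>The generators are the elements of a finite type \<open>'n\<close>, the free semigroup is \<open>'n list\<close>.
  Since the \<open>e\<^sub>\<alpha>\<close> form an orthonormal basis of the full Fock space, its Hilbert tensor product with
  \<open>'e\<close> is the space of square-summable families of vectors of \<open>'e\<close> indexed by words: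
  a family \<open>h\<close> stands for the sum of the \<open>e\<^sub>\<alpha> \<otimes> h \<alpha>\<close>.  The full Fock space itself is the case
  \<open>'e = complex\<close>.\<close>

type_synonym ('n, 'e) fock = "('n list, 'e) l2"

definition tensor :: "('n, complex) fock \<Rightarrow> 'e::chilbert_space \<Rightarrow> ('n, 'e) fock" where
  "tensor \<phi> x = Abs_l2 (\<lambda>\<alpha>. Rep_l2 \<phi> \<alpha> *\<^sub>C x)"

lemma Rep_tensor: "Rep_l2 (tensor \<phi> x) \<alpha> = Rep_l2 \<phi> \<alpha> *\<^sub>C x"
proof -
  have "(\<lambda>\<alpha>. (cmod (Rep_l2 \<phi> \<alpha>))\<^sup>2 * (norm x)\<^sup>2) summable_on UNIV"
    using Rep_l2[of \<phi>] by (intro summable_on_cmult_left) simp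
  then show ?thesis
    by (simp add: tensor_def Abs_l2_inverse norm_scaleC power_mult_distrib)
qed

lemma cinner_tensor: "cinner (tensor \<phi> x) (tensor \<psi> y) = cinner \<phi> \<psi> * cinner x y"
proof -
  have "cinner (c *\<^sub>C x) (d *\<^sub>C y) = cinner c d * cinner x y" for c d
  proof -
    have "cinner x (d *\<^sub>C y) = cnj d * cinner x y"
      by (metis cinner_commute cinner_scaleC_left complex_cnj_mult)
    then show ?thesis by (simp add: cinner_scaleC_left cinner_complex_def)
  qed
  then show ?thesis
    by (simp add: cinner_l2.rep_eq Rep_tensor infsum_cmult_left')
qed

text \<open>\<open>I \<otimes> V\<close>, and the subspace \<open>F\<^sup>2 \<otimes> G\<close>.\<close>

definition ampl :: "('d::chilbert_space \<Rightarrow> 'e::chilbert_space) \<Rightarrow> ('n, 'd) fock \<Rightarrow> ('n, 'e) fock" where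
  "ampl V h = Abs_l2 (\<lambda>\<alpha>. V (Rep_l2 h \<alpha>))"

definition fock_sub :: "'e::chilbert_space set \<Rightarrow> ('n, 'e) fock set" where
  "fock_sub G = {h. \<forall>\<alpha>. Rep_l2 h \<alpha> \<in> G}"

text \<open>\<open>S\<^sub>i \<otimes> I\<close>, \<open>D\<^sub>i \<otimes> I\<close> and \<open>W\<^sub>i \<otimes> I\<close>.  The weights of \<open>D\<^sub>i\<close> are bounded for admissible \<open>b\<close>.\<close>

definition creation :: "'n \<Rightarrow> ('n, 'e::chilbert_space) fock \<Rightarrow> ('n, 'e) fock" where
  "creation i h = Abs_l2 (\<lambda>\<alpha>. case \<alpha> of [] \<Rightarrow> 0 | j # \<beta> \<Rightarrow> if j = i then Rep_l2 h \<beta> else 0)"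

definition weight_op :: "('n list \<Rightarrow> real) \<Rightarrow> 'n \<Rightarrow> ('n, 'e::chilbert_space) fock \<Rightarrow> ('n, 'e) fock" where
  "weight_op b i h = Abs_l2 (\<lambda>\<alpha>. sqrt (b \<alpha> / b (i # \<alpha>)) *\<^sub>R Rep_l2 h \<alpha>)"

definition model :: "('n list \<Rightarrow> real) \<Rightarrow> 'n \<Rightarrow> ('n, 'e::chilbert_space) fock \<Rightarrow> ('n, 'e) fock" where
  "model b i = creation i \<circ> weight_op b i"

lemma Rep_creation:
  "Rep_l2 (creation i h) = (\<lambda>\<alpha>. case \<alpha> of [] \<Rightarrow> 0 | j # \<beta> \<Rightarrow> if j = i then Rep_l2 h \<beta> else 0)"
proof -
  let ?k = "\<lambda>\<alpha>. case \<alpha> of [] \<Rightarrow> 0 | j # \<beta> \<Rightarrow> if j = i then Rep_l2 h \<beta> else 0"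
  have "(\<lambda>\<alpha>. (norm (?k \<alpha>))\<^sup>2) summable_on range ((#) i)"
    using Rep_l2[of h] by (subst summable_on_reindex) (auto simp: o_def)
  also have "?this \<longleftrightarrow> (\<lambda>\<alpha>. (norm (?k \<alpha>))\<^sup>2) summable_on UNIV"
    by (rule summable_on_cong_neutral) (auto split: list.splits)
  finally show ?thesis by (simp add: creation_def Abs_l2_inverse)
qed

lemma Rep_weight_op:
  assumes pos: "\<And>\<alpha>. 0 < b \<alpha>" and bdd: "bdd_above (range (\<lambda>\<alpha>. b \<alpha> / b (i # \<alpha>)))"
  shows "Rep_l2 (weight_op b i h) = (\<lambda>\<alpha>. sqrt (b \<alpha> / b (i # \<alpha>)) *\<^sub>R Rep_l2 h \<alpha>)"
proof -
  obtain C where C: "b \<alpha> / b (i # \<alpha>) \<le> C" for \<alpha>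
    using bdd by (auto simp: bdd_above_def)
  have nn: "0 \<le> b \<alpha> / b (i # \<alpha>)" for \<alpha>
    by (simp add: pos less_imp_le)
  have eq: "(norm (sqrt (b \<alpha> / b (i # \<alpha>)) *\<^sub>R Rep_l2 h \<alpha>))\<^sup>2
      = b \<alpha> / b (i # \<alpha>) * (norm (Rep_l2 h \<alpha>))\<^sup>2" for \<alpha>
    using nn[of \<alpha>] by (simp add: power_mult_distrib del: real_sqrt_divide)
  have "(\<lambda>\<alpha>. C * (norm (Rep_l2 h \<alpha>))\<^sup>2) summable_on UNIV"
    using Rep_l2[of h] by (intro summable_on_cmult_right) simp
  then have "(\<lambda>\<alpha>. b \<alpha> / b (i # \<alpha>) * (norm (Rep_l2 h \<alpha>))\<^sup>2) summable_on UNIV"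
    by (rule summable_on_comparison_test) (use nn C in \<open>auto intro!: mult_right_mono mult_nonneg_nonneg
        simp del: times_divide_eq_left\<close>)
  then show ?thesis
    unfolding weight_op_def by (subst Abs_l2_inverse) (simp_all only: eq mem_Collect_eq)
qed

lemma model_tensor:
  assumes "\<And>\<alpha>. 0 < b \<alpha>" and "bdd_above (range (\<lambda>\<alpha>. b \<alpha> / b (i # \<alpha>)))"
  shows "model b i (tensor \<phi> x) = tensor (model b i \<phi>) x"
proof -
  have "0 *\<^sub>C x = 0" by (metis of_real_0 scaleR_scaleC scale_zero_left)
  then show ?thesis
    by (intro Rep_l2_inject[THEN iffD1] ext)
      (auto simp: model_def Rep_creation Rep_weight_op[OF assms] Rep_tensor scaleR_scaleC
        scaleC_scaleC scaleC_complex_def split: list.splits)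
qed

primrec word_op :: "('n \<Rightarrow> 'a \<Rightarrow> 'a) \<Rightarrow> 'n list \<Rightarrow> 'a \<Rightarrow> 'a" where
  "word_op X [] = id"
| "word_op X (i # \<alpha>) = X i \<circ> word_op X \<alpha>"

section \<open>Admissible free holomorphic functions and their domains\<close>

text \<open>A formal power series in noncommuting indeterminates is its family of coefficients.\<close>

definition nc_mult :: "('n list \<Rightarrow> real) \<Rightarrow> ('n list \<Rightarrow> real) \<Rightarrow> 'n list \<Rightarrow> real" where
  "nc_mult u v \<gamma> = (\<Sum>k\<le>length \<gamma>. u (take k \<gamma>) * v (drop k \<gamma>))"

definition nc_one :: "'n list \<Rightarrow> real" where
  "nc_one \<gamma> = (if \<gamma> = [] then 1 else 0)"

definition nc_inverse :: "('n list \<Rightarrow> real) \<Rightarrow> 'n list \<Rightarrow> real" where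
  "nc_inverse b = (THE a. nc_mult b a = nc_one \<and> nc_mult a b = nc_one)"

lemma nc_mult_Nil: "nc_mult u v [] = u [] * v []"
  by (simp add: nc_mult_def)

lemma nc_mult_Cons: "nc_mult u v (i # \<gamma>) = u [] * v (i # \<gamma>) + nc_mult (\<lambda>\<alpha>. u (i # \<alpha>)) v \<gamma>"
  by (simp add: nc_mult_def sum.atMost_Suc_shift del: sum.atMost_Suc)

lemma nc_mult_assoc: "nc_mult (nc_mult u v) w = nc_mult u (nc_mult v w)"
proof
  fix \<gamma>
  have lin: "nc_mult (\<lambda>\<alpha>. c * p \<alpha> + q \<alpha>) w \<gamma> = c * nc_mult p w \<gamma> + nc_mult q w \<gamma>" for c p q \<gamma>
    by (simp add: nc_mult_def algebra_simps sum.distrib sum_distrib_left)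
  show "nc_mult (nc_mult u v) w \<gamma> = nc_mult u (nc_mult v w) \<gamma>"
    by (induction \<gamma> arbitrary: u) (simp_all add: nc_mult_Nil nc_mult_Cons lin algebra_simps)
qed

lemma nc_mult_one: "nc_mult nc_one u = u" "nc_mult u nc_one = u"
proof -
  have zero: "nc_mult (\<lambda>_. 0) u \<gamma> = 0" for \<gamma> by (simp add: nc_mult_def)
  show "nc_mult nc_one u = u"
  proof
    show "nc_mult nc_one u \<gamma> = u \<gamma>" for \<gamma>
      by (cases \<gamma>) (simp_all add: nc_mult_Nil nc_mult_Cons nc_one_def zero)
  qed
  show "nc_mult u nc_one = u"
  proof
    show "nc_mult u nc_one \<gamma> = u \<gamma>" for \<gamma>
      by (induction \<gamma> arbitrary: u) (simp_all add: nc_mult_Nil nc_mult_Cons nc_one_def)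
  qed
qed

function nc_rinv :: "('n list \<Rightarrow> real) \<Rightarrow> 'n list \<Rightarrow> real" where
  "nc_rinv b [] = 1"
| "nc_rinv b (i # \<gamma>) = - (\<Sum>k\<le>length \<gamma>. b (i # take k \<gamma>) * nc_rinv b (drop k \<gamma>))"
  by pat_completeness auto
termination by (relation "inv_image less_than (length \<circ> snd)") auto

lemma nc_mult_rinv: "b [] = 1 \<Longrightarrow> nc_mult b (nc_rinv b) = nc_one"
proof
  fix \<gamma> assume b: "b [] = 1"
  show "nc_mult b (nc_rinv b) \<gamma> = nc_one \<gamma>"
  proof (cases \<gamma>)
    case Nil
    then show ?thesis using b by (simp add: nc_mult_Nil nc_one_def)
  next
    case (Cons i \<beta>)
    have "nc_mult b (nc_rinv b) (i # \<beta>) = 0"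
      unfolding nc_mult_Cons by (simp add: b nc_mult_def)
    then show ?thesis by (simp add: Cons nc_one_def)
  qed
qed

lemma nc_inverse:
  assumes "b [] = 1"
  shows "nc_mult b (nc_inverse b) = nc_one" "nc_mult (nc_inverse b) b = nc_one"
proof -
  let ?a = "nc_rinv b"
  have r: "nc_mult b ?a = nc_one" using assms by (rule nc_mult_rinv)
  have "nc_mult ?a (nc_rinv ?a) = nc_one" by (rule nc_mult_rinv) simp
  with r have "nc_rinv ?a = b" by (metis nc_mult_assoc nc_mult_one)
  then have l: "nc_mult ?a b = nc_one" using nc_mult_rinv[of ?a] by simp
  have "\<exists>!a. nc_mult b a = nc_one \<and> nc_mult a b = nc_one"
    using r l by (metis nc_mult_assoc nc_mult_one)
  from theI'[OF this]
  show "nc_mult b (nc_inverse b) = nc_one" "nc_mult (nc_inverse b) b = nc_one"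
    unfolding nc_inverse_def by blast+
qed

text \<open>Partial sums of the series defining \<open>\<Delta>(X, X\<^sup>*)\<close>.\<close>

definition defect_partial ::
  "('n::finite list \<Rightarrow> real) \<Rightarrow> 'a::chilbert_space set \<Rightarrow> ('n \<Rightarrow> 'a \<Rightarrow> 'a) \<Rightarrow> nat \<Rightarrow> 'a \<Rightarrow> 'a" where
  "defect_partial b H X k x = (\<Sum>p\<le>k. \<Sum>\<alpha> | length \<alpha> = p.
     nc_inverse b \<alpha> *\<^sub>R word_op X \<alpha> (adj H (word_op X \<alpha>) x))"

definition admissible :: "('n::finite list \<Rightarrow> real) \<Rightarrow> bool" where
  "admissible b \<longleftrightarrow>
     (\<forall>\<alpha>. 0 < b \<alpha>) \<and> b [] = 1 \<and> (\<forall>i. bdd_above (range (\<lambda>\<alpha>. b \<alpha> / b (i # \<alpha>))))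
     \<and> limsup (\<lambda>k. ereal ((\<Sum>\<alpha> | length \<alpha> = k. (b \<alpha>)\<^sup>2) powr (1 / (2 * real k)))) < \<infinity>
     \<and> bdd_above (range (\<lambda>k. onorm
          (defect_partial b UNIV (model b :: 'n \<Rightarrow> ('n, complex) fock \<Rightarrow> ('n, complex) fock) k)))"

definition regular_domain :: "('n list \<Rightarrow> real) \<Rightarrow> bool" where
  "regular_domain b \<longleftrightarrow>
     (\<forall>\<alpha>. 1 \<le> length \<alpha> \<longrightarrow> nc_inverse b \<alpha> \<le> 0) \<and> (\<forall>i. nc_inverse b [i] < 0)"

text \<open>\<open>\<Delta>\<close> is \<open>\<Delta>(X, X\<^sup>*)\<close> and \<open>L\<close> is the WOT sum of all \<open>b\<^sub>\<alpha> X\<^sub>\<alpha> \<Delta> X\<^sub>\<alpha>\<^sup>*\<close>.  The tuple \<open>X\<close> belongs to the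
  domain over \<open>H\<close> if such \<open>\<Delta>\<close> and \<open>L\<close> exist; both are determined by \<open>X\<close> on \<open>H\<close>.\<close>

definition domain_witness :: "('n::finite list \<Rightarrow> real) \<Rightarrow> 'a::chilbert_space set \<Rightarrow>
    ('n \<Rightarrow> 'a \<Rightarrow> 'a) \<Rightarrow> ('a \<Rightarrow> 'a) \<Rightarrow> ('a \<Rightarrow> 'a) \<Rightarrow> bool" where
  "domain_witness b H X \<Delta> L \<longleftrightarrow>
     (\<forall>i. bounded_op H H (X i))
     \<and> wot_tendsto H (defect_partial b H X) \<Delta> sequentially \<and> positive_op H \<Delta>
     \<and> wot_tendsto H
         (\<lambda>A x. \<Sum>\<alpha>\<in>A. b \<alpha> *\<^sub>R word_op X \<alpha> (\<Delta> (adj H (word_op X \<alpha>) x))) L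
         (finite_subsets_at_top UNIV)
     \<and> positive_op H (\<lambda>x. x - L x)"

text \<open>HOL has no quantifier over types, hence none over all Hilbert spaces.  Every Hilbert space is
  unitarily equivalent to a closed subspace \<open>H\<close> of \<open>('i, complex) l2\<close> for a large enough \<open>'i\<close>, so an
  inclusion of pure domains over every Hilbert space is an inclusion over all these \<open>H\<close>.  A theorem
  that assumes it for one arbitrary infinite \<open>'i\<close> only assumes part of the full inclusion.\<close>

definition pure_domain ::
  "('n::finite list \<Rightarrow> real) \<Rightarrow> 'a::chilbert_space set \<Rightarrow> ('n \<Rightarrow> 'a \<Rightarrow> 'a) set" where
  "pure_domain b H = {X. \<exists>\<Delta> L. domain_witness b H X \<Delta> L \<and> (\<forall>x\<in>H. L x = x)}"

section \<open>Multi-analytic operators and their supports\<close>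

definition multi_analytic :: "('n list \<Rightarrow> real) \<Rightarrow> ('n list \<Rightarrow> real) \<Rightarrow>
    (('n, 'e::chilbert_space) fock \<Rightarrow> ('n, 'k::chilbert_space) fock) \<Rightarrow> bool" where
  "multi_analytic g f \<Psi> \<longleftrightarrow> bounded_op UNIV UNIV \<Psi> \<and> (\<forall>i h. \<Psi> (model g i h) = model f i (\<Psi> h))"

definition reducing :: "('n list \<Rightarrow> real) \<Rightarrow> ('n, 'e::chilbert_space) fock set \<Rightarrow> bool" where
  "reducing g M \<longleftrightarrow> closed_csubspace M
     \<and> (\<forall>i. model g i ` M \<subseteq> M \<and> adj UNIV (model g i) ` M \<subseteq> M)"

definition supp :: "('n list \<Rightarrow> real) \<Rightarrow>
    (('n, 'e::chilbert_space) fock \<Rightarrow> ('n, 'k::chilbert_space) fock) \<Rightarrow> ('n, 'e) fock set" where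
  "supp g \<Psi> = \<Inter>{M. reducing g M \<and> closure (range (adj UNIV \<Psi>)) \<subseteq> M}"

definition coincide :: "'d::chilbert_space set \<Rightarrow> (('n, 'd) fock \<Rightarrow> ('n, 'k::chilbert_space) fock) \<Rightarrow>
    'e::chilbert_space set \<Rightarrow> (('n, 'e) fock \<Rightarrow> ('n, 'k) fock) \<Rightarrow> bool" where
  "coincide G\<^sub>1 A\<^sub>1 G\<^sub>2 A\<^sub>2 \<longleftrightarrow>
     (\<exists>\<tau>. unitary_op G\<^sub>1 G\<^sub>2 \<tau> \<and> (\<forall>h\<in>fock_sub G\<^sub>1. A\<^sub>1 h = A\<^sub>2 (ampl \<tau> h)))"

end

theory Submission
  imports Defs
begin

text \<open>The partial isometries satisfy \<open>\<Psi>\<^sub>1 \<Psi>\<^sub>1\<^sup>* = \<Psi>\<^sub>2 \<Psi>\<^sub>2\<^sup>*\<close>, both sides being the projection onto the common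
  range.  The operators \<open>\<Delta>\<^sub>k = \<Sum>\<^bsub>|\<alpha>| \<le> k\<^esub> a\<^sub>\<alpha> W\<^sub>\<alpha> W\<^sub>\<alpha>\<^sup>*\<close> of the model of \<open>g\<close> converge strongly to the projection
  \<open>P\<close> onto the constants, and \<open>\<Psi>\<^sub>j \<Delta>\<^sub>k \<Psi>\<^sub>j\<^sup>*\<close> only depends on \<open>\<Psi>\<^sub>j \<Psi>\<^sub>j\<^sup>*\<close> because \<open>\<Psi>\<^sub>j\<close> intertwines the models.
  Hence \<open>\<Psi>\<^sub>1 P \<Psi>\<^sub>1\<^sup>* = \<Psi>\<^sub>2 P \<Psi>\<^sub>2\<^sup>*\<close>, that is, \<open>A\<^sub>1 A\<^sub>1\<^sup>* = A\<^sub>2 A\<^sub>2\<^sup>*\<close> for the restrictions \<open>A\<^sub>j\<close> of \<open>\<Psi>\<^sub>j\<close> to the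
  constants.  Douglas' lemma gives a partial isometry \<open>V\<close> with \<open>A\<^sub>1 = A\<^sub>2 V\<close>, which maps the closure \<open>G\<^sub>1\<close> of the
  range of \<open>A\<^sub>1\<^sup>*\<close> onto the closure \<open>G\<^sub>2\<close> of the range of \<open>A\<^sub>2\<^sup>*\<close>; and multi-analytic operators are determined
  by their values on constants.  Since \<open>P\<close> leaves every reducing subspace invariant, the support of \<open>\<Psi>\<^sub>j\<close> is
  \<open>F\<^sup>2 \<otimes> G\<^sub>j\<close>.\<close>

section \<open>Hilbert space geometry\<close>

lemma cinner_add_right: "cinner x (y + z) = cinner x y + cinner x (z :: 'a::chilbert_space)"
  by (metis cinner_add_left cinner_commute complex_cnj_add)

lemma cinner_scaleC_right: "cinner x (c *\<^sub>C y) = cnj c * cinner x (y :: 'a::chilbert_space)"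
  by (metis cinner_commute cinner_scaleC_left complex_cnj_mult)

text \<open>Over the reals the sesquilinear form is bilinear; the interpretation below then supplies
  its continuity, difference and zero rules.\<close>

lemma bounded_bilinear_cinner:
  "bounded_bilinear (cinner :: 'a::chilbert_space \<Rightarrow> 'a \<Rightarrow> complex)"
  by standard
    (auto simp: cinner_add_left cinner_add_right scaleR_scaleC cinner_scaleC_left cinner_scaleC_right
      scaleC_complex_def intro!: exI[of _ 1] cmod_cinner_le)

interpretation cinner: bounded_bilinear "cinner :: 'a::chilbert_space \<Rightarrow> 'a \<Rightarrow> complex"
  by (rule bounded_bilinear_cinner)

lemma cinner_self_eq_0_iff: "cinner x x = 0 \<longleftrightarrow> x = (0 :: 'a::chilbert_space)"
  by (simp add: cinner_self)

lemma scaleC_zero_right: "c *\<^sub>C (0 :: 'a::chilbert_space) = 0"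
  by (metis scaleC_add_right add_cancel_right_right)

lemma norm_add_sq:
  "(norm (x + y :: 'a::chilbert_space))\<^sup>2 = (norm x)\<^sup>2 + (norm y)\<^sup>2 + 2 * Re (cinner x y)"
proof -
  have "cinner (x + y) (x + y) = cinner x x + cinner y y + (cinner x y + cnj (cinner x y))"
    by (simp add: cinner.add_left cinner.add_right flip: cinner_commute[of y x])
  then show ?thesis unfolding cinner_self by (simp add: complex_eq_iff)
qed

lemma cinner_eqI: "(\<And>z. cinner z x = cinner z y) \<Longrightarrow> x = (y :: 'a::chilbert_space)"
  using cinner_self_eq_0_iff[of "x - y"] by (simp add: cinner.diff_right)

lemma closed_csubspaceD:
  assumes "closed_csubspace (H :: 'a::chilbert_space set)"
  shows "closed H" "0 \<in> H" "x \<in> H \<Longrightarrow> y \<in> H \<Longrightarrow> x + y \<in> H" "x \<in> H \<Longrightarrow> c *\<^sub>C x \<in> H"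
    "x \<in> H \<Longrightarrow> r *\<^sub>R x \<in> H" "x \<in> H \<Longrightarrow> y \<in> H \<Longrightarrow> x - y \<in> H"
proof -
  show "closed H" "0 \<in> H" "x \<in> H \<Longrightarrow> y \<in> H \<Longrightarrow> x + y \<in> H" and sc: "x \<in> H \<Longrightarrow> c *\<^sub>C x \<in> H" for x y c
    using assms by (auto simp: closed_csubspace_def)
  show sr: "x \<in> H \<Longrightarrow> r *\<^sub>R x \<in> H" for x r using sc by (simp add: scaleR_scaleC)
  show "x \<in> H \<Longrightarrow> y \<in> H \<Longrightarrow> x - y \<in> H"
    using sr[of y "-1"] assms by (auto simp: closed_csubspace_def diff_conv_add_uminus simp del: add_uminus_conv_diff)
qed

lemma closed_csubspace_sum:
  assumes "closed_csubspace H" "\<And>i. i \<in> A \<Longrightarrow> u i \<in> H"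
  shows "(\<Sum>i\<in>A. u i) \<in> H"
  using assms(2) by (induction A rule: infinite_finite_induct) (auto intro: closed_csubspaceD[OF assms(1)])

lemma closed_csubspace_UNIV: "closed_csubspace UNIV"
  by (simp add: closed_csubspace_def)

text \<open>The representing vector minimises \<open>J x = \<parallel>x\<parallel>\<^sup>2 - 2 Re (\<phi> x)\<close>; by the parallelogram
  law every minimising sequence is Cauchy.\<close>

lemma riesz_ex:
  fixes \<phi> :: "'a::chilbert_space \<Rightarrow> complex"
  assumes H: "closed_csubspace H" and \<phi>: "bounded_op H UNIV \<phi>"
  shows "\<exists>x\<in>H. \<forall>z\<in>H. \<phi> z = cinner z x"
proof -
  note Hs = closed_csubspaceD[OF H]
  have add: "\<phi> (x + y) = \<phi> x + \<phi> y" if "x \<in> H" "y \<in> H" for x y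
    using \<phi> that by (simp add: bounded_op_def)
  have sc: "\<phi> (c *\<^sub>C x) = c * \<phi> x" if "x \<in> H" for x c
    using \<phi> that by (simp add: bounded_op_def scaleC_complex_def)
  have sr: "\<phi> (r *\<^sub>R x) = of_real r * \<phi> x" if "x \<in> H" for x r
    using sc[OF that] by (simp add: scaleR_scaleC)
  obtain C where C: "cmod (\<phi> x) \<le> C * norm x" if "x \<in> H" for x
    using \<phi> unfolding bounded_op_def by blast
  define J where "J x = (norm x)\<^sup>2 - 2 * Re (\<phi> x)" for x
  \<comment> \<open>Completing the square bounds \<open>J\<close> from below, so its infimum over
    \<open>H\<close> is finite.\<close>
  have J_lower: "- C\<^sup>2 \<le> J x" if "x \<in> H" for x
  proof -
    have "Re (\<phi> x) \<le> C * norm x" using C[OF that] complex_Re_le_cmod[of "\<phi> x"] by linarith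
    then have "(norm x)\<^sup>2 - 2 * (C * norm x) \<le> J x" by (simp add: J_def)
    moreover have "0 \<le> (norm x - C)\<^sup>2" by simp
    ultimately show ?thesis by (simp add: power2_diff algebra_simps)
  qed
  define m where "m = Inf (J ` H)"
  have bdd: "bdd_below (J ` H)" using J_lower by (auto intro!: bdd_belowI)
  have m_le: "m \<le> J x" if "x \<in> H" for x
    unfolding m_def using bdd that by (intro cInf_lower) auto
  \<comment> \<open>The midpoint of \<open>x\<close> and \<open>y\<close> lies in \<open>H\<close>,
    so \<open>J\<close> is at least \<open>m\<close> there.\<close>
  have par: "(norm (x - y))\<^sup>2 \<le> 2 * (J x - m) + 2 * (J y - m)" if "x \<in> H" "y \<in> H" for x y
  proof -
    have eq1: "(norm ((1/2) *\<^sub>R (x + y)))\<^sup>2 = ((norm x)\<^sup>2 + (norm y)\<^sup>2 + 2 * Re (cinner x y)) / 4"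
      by (simp add: norm_add_sq power_divide)
    have "(norm (x - y))\<^sup>2 = (norm x)\<^sup>2 + (norm y)\<^sup>2 - 2 * Re (cinner x y)"
      using norm_add_sq[of x "- y"] by (simp add: cinner.minus_right)
    moreover have "m \<le> J ((1/2) *\<^sub>R (x + y))" using that Hs by (intro m_le) auto
    moreover have "Re (\<phi> ((1/2) *\<^sub>R (x + y))) = (Re (\<phi> x) + Re (\<phi> y)) / 2"
      using sr[OF Hs(3)[OF that], of "1/2"] add[OF that] by (simp add: complex_eq_iff)
    ultimately show ?thesis unfolding J_def eq1 by argo
  qed
  have "\<exists>x\<in>H. J x < m + 1 / Suc n" for n
    using cInf_lessD[of "J ` H" "m + 1 / Suc n"] Hs(2) by (auto simp: m_def)
  then obtain u where u: "u n \<in> H" "J (u n) < m + 1 / Suc n" for n by metis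
  have "Cauchy u"
  proof (rule metric_CauchyI)
    fix e :: real assume e: "0 < e"
    obtain N where N: "4 / e\<^sup>2 < Suc N" using reals_Archimedean2[of "4 / e\<^sup>2"]
      by (metis less_trans lessI of_nat_less_iff)
    have "dist (u p) (u q) < e" if "p \<ge> N" "q \<ge> N" for p q
    proof -
      have le: "J (u n) - m < 1 / Suc N" if "n \<ge> N" for n
      proof -
        have "1 / real (Suc n) \<le> 1 / Suc N" using that by (simp add: frac_le)
        then show ?thesis using u(2)[of n] by linarith
      qed
      have "(norm (u p - u q))\<^sup>2 < 4 / Suc N"
        using par[OF u(1) u(1), of p q] le[OF that(1)] le[OF that(2)] by simp
      also have "\<dots> < e\<^sup>2" using N e by (simp add: field_simps)
      finally show ?thesis using e by (simp add: dist_norm power_less_imp_less_base)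
    qed
    then show "\<exists>M. \<forall>m\<ge>M. \<forall>n\<ge>M. dist (u m) (u n) < e" by blast
  qed
  then obtain x where lim: "u \<longlonglongrightarrow> x" using Cauchy_convergent convergent_def by blast
  have x: "x \<in> H" using closed_sequentially[OF Hs(1) _ lim] u(1) by blast
  have "(\<lambda>n. \<phi> (u n)) \<longlonglongrightarrow> \<phi> x"
  proof (rule LIM_zero_cancel, rule Lim_null_comparison)
    have "\<phi> (u n) - \<phi> x = \<phi> (u n - x)" for n
      using add[of "u n - x" x] u(1) x Hs by simp
    then show "\<forall>\<^sub>F n in sequentially. norm (\<phi> (u n) - \<phi> x) \<le> C * norm (u n - x)"
      using C u(1) x Hs by simp
    show "(\<lambda>n. C * norm (u n - x)) \<longlonglongrightarrow> 0"
      using lim by (intro tendsto_mult_right_zero tendsto_norm_zero) (simp add: LIM_zero)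
  qed
  then have Jlim: "(\<lambda>n. J (u n)) \<longlonglongrightarrow> J x" unfolding J_def by (intro tendsto_intros lim)
  have "(\<lambda>n. m + 1 / Suc n) \<longlonglongrightarrow> m + 0"
    by (intro tendsto_intros LIMSEQ_Suc[OF lim_1_over_n])
  then have "J x \<le> m + 0"
    by (rule LIMSEQ_le[OF Jlim]) (use u(2) less_imp_le in blast)
  then have min: "J x \<le> J y" if "y \<in> H" for y using m_le[OF that] by simp
  have re: "Re (\<phi> z) = Re (cinner z x)" if z: "z \<in> H" for z
  proof -
    define d where "d = Re (cinner z x) - Re (\<phi> z)"
    have "Re (cinner x z) = Re (cinner z x)" by (subst cinner_commute) simp
    then have q: "0 \<le> t\<^sup>2 * (norm z)\<^sup>2 + 2 * t * d" for t
      using min[of "x + t *\<^sub>R z"] z x Hs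
      by (simp add: J_def norm_add_sq add sr power_mult_distrib cinner.scaleR_right d_def algebra_simps)
    \<comment> \<open>The quadratic in \<open>t\<close> is tested at \<open>- d / s\<close>. Its
      minimum belongs to \<open>s = (norm z)^2\<close>; the added 1 covers \<open>z = 0\<close> and
      keeps the factor \<open>(norm z)^2 - 2 * s\<close> negative.\<close>
    define s where "s = (norm z)\<^sup>2 + 1"
    have s: "s > 0" by (simp add: s_def add_nonneg_pos)
    have "d = 0"
    proof -
      have "0 \<le> (- d / s)\<^sup>2 * (norm z)\<^sup>2 + 2 * (- d / s) * d" by (rule q)
      also have "\<dots> = (d\<^sup>2 / s\<^sup>2) * ((norm z)\<^sup>2 - 2 * s)"
        using s by (simp add: field_simps power2_eq_square)
      finally have "0 \<le> (d\<^sup>2 / s\<^sup>2) * ((norm z)\<^sup>2 - 2 * s)" .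
      moreover have "(norm z)\<^sup>2 - 2 * s < 0" by (simp add: s_def) (smt (verit) zero_le_power2)
      ultimately have "d\<^sup>2 / s\<^sup>2 \<le> 0" by (meson mult_pos_neg not_le)
      then show "d = 0" using s by (simp add: divide_le_0_iff)
    qed
    then show ?thesis by (simp add: d_def)
  qed
  \<comment> \<open>Equality of real parts at \<open>\<i> *\<^sub>C z\<close> is equality of
    imaginary parts at \<open>z\<close>.\<close>
  have "\<phi> z = cinner z x" if z: "z \<in> H" for z
    using re[OF z] re[OF Hs(4)[OF z, of \<i>]] z by (simp add: sc cinner_scaleC_left complex_eq_iff)
  then show ?thesis using x by blast
qed

section \<open>Adjoints and orthogonal projections\<close>

text \<open>Two candidates for the definite description differ by an element of \<open>H\<close>
  that is orthogonal to itself.\<close>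

lemma adj_eqI:
  assumes H: "closed_csubspace H" and x: "x \<in> H" "\<And>z. z \<in> H \<Longrightarrow> cinner (T z) y = cinner z x"
  shows "adj H T y = x"
  unfolding adj_def
proof (rule the_equality)
  fix x' assume x': "x' \<in> H \<and> (\<forall>z\<in>H. cinner (T z) y = cinner z x')"
  have "x' - x \<in> H" using x' x closed_csubspaceD(6)[OF H] by simp
  then have "cinner (x' - x) (x' - x) = 0" using x x' by (simp add: cinner.diff_right)
  then show "x' = x" by (simp add: cinner_self_eq_0_iff)
qed (use x in simp)

text \<open>Existence is the Riesz representation of the functional
  \<open>\<lambda>z. cinner (T z) y\<close> on \<open>H\<close>.\<close>

lemma adj_in_cinner:
  fixes T :: "'a::chilbert_space \<Rightarrow> 'b::chilbert_space"
  assumes H: "closed_csubspace H" and T: "bounded_op H UNIV T"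
  shows "adj H T y \<in> H \<and> (\<forall>z\<in>H. cinner (T z) y = cinner z (adj H T y))"
proof -
  obtain C where C: "norm (T x) \<le> C * norm x" if "x \<in> H" for x
    using T unfolding bounded_op_def by blast
  have "cmod (cinner (T x) y) \<le> (C * norm y) * norm x" if "x \<in> H" for x
    using order_trans[OF cmod_cinner_le mult_right_mono[OF C[OF that] norm_ge_zero]]
    by (simp add: mult_ac)
  then have "bounded_op H UNIV (\<lambda>z. cinner (T z) y)"
    using T unfolding bounded_op_def
    by (auto simp: cinner_add_left cinner_scaleC_left scaleC_complex_def)
  from riesz_ex[OF H this] obtain x where "x \<in> H" "\<forall>z\<in>H. cinner (T z) y = cinner z x" by blast
  moreover from this have "adj H T y = x" by (intro adj_eqI H) auto
  ultimately show ?thesis by simp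
qed

lemma cinner_adj:
  assumes "bounded_op UNIV UNIV T"
  shows "cinner (T z) y = cinner z (adj UNIV T y)"
  using adj_in_cinner[OF closed_csubspace_UNIV assms] by blast

lemma cinner_adj_left:
  assumes "bounded_op UNIV UNIV T"
  shows "cinner (adj UNIV T y) z = cinner y (T z)"
  using cinner_adj[OF assms, of z y] by (metis cinner_commute)

text \<open>The adjoint of the inclusion of \<open>G\<close> is the orthogonal projection onto
  \<open>G\<close>.\<close>

lemma projection_ex:
  assumes G: "closed_csubspace G"
  shows "\<exists>p\<in>G. \<forall>z\<in>G. cinner z (x - p) = 0"
proof (rule bexI[of _ "adj G id x"])
  have "bounded_op G UNIV id" by (auto simp: bounded_op_def intro: exI[of _ 1])
  from adj_in_cinner[OF G this, of x]
  show "adj G id x \<in> G" "\<forall>z\<in>G. cinner z (x - adj G id x) = 0"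
    by (auto simp: cinner.diff_right)
qed

lemma bounded_op_imp_bounded_linear:
  assumes "bounded_op UNIV UNIV T"
  shows "bounded_linear T"
proof -
  obtain C where "\<forall>x. norm (T x) \<le> C * norm x" using assms by (auto simp: bounded_op_def)
  then show ?thesis using assms
    by (intro bounded_linear_intro[where K = C]) (auto simp: bounded_op_def scaleR_scaleC mult.commute)
qed

lemma bounded_opI:
  assumes "bounded_linear T" "\<And>c x. T (c *\<^sub>C x) = c *\<^sub>C T x"
  shows "bounded_op UNIV UNIV T"
proof -
  obtain C where "\<And>x. norm (T x) \<le> norm x * C" using bounded_linear.bounded[OF assms(1)] by blast
  then show ?thesis using assms unfolding bounded_op_def
    by (auto simp: linear_simps mult.commute)
qed

lemma bounded_op_scaleC: "bounded_op UNIV UNIV T \<Longrightarrow> T (c *\<^sub>C x) = c *\<^sub>C T x"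
  by (simp add: bounded_op_def)

lemma bounded_op_compose:
  assumes "bounded_op UNIV UNIV S" "bounded_op UNIV UNIV T"
  shows "bounded_op UNIV UNIV (\<lambda>x. S (T x))"
  by (rule bounded_opI, rule bounded_linear_compose[OF assms[THEN bounded_op_imp_bounded_linear]])
    (simp add: assms[THEN bounded_op_scaleC])

lemma bounded_op_adj:
  assumes T: "bounded_op UNIV UNIV T"
  shows "bounded_op UNIV UNIV (adj UNIV T)"
proof -
  note a = cinner_adj[OF T, symmetric]
  obtain C where "0 \<le> C" and C: "\<And>x. norm (T x) \<le> C * norm x"
    using bounded_linear.nonneg_bounded[OF bounded_op_imp_bounded_linear[OF T]] by (metis mult.commute)
  have bd: "norm (adj UNIV T y) \<le> C * norm y" for y
  proof (cases "adj UNIV T y = 0")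
    case True
    then show ?thesis using \<open>0 \<le> C\<close> by simp
  next
    case False
    \<comment> \<open>The squared norm is the inner product of \<open>T (adj UNIV T y)\<close> with
      \<open>y\<close>; Cauchy-Schwarz then allows one factor \<open>norm (adj UNIV T y)\<close> to
      be cancelled.\<close>
    have "(norm (adj UNIV T y))\<^sup>2 = cmod (cinner (adj UNIV T y) (adj UNIV T y))"
      by (simp add: cinner_self norm_power)
    also have "\<dots> = cmod (cinner (T (adj UNIV T y)) y)" by (simp add: a)
    also have "\<dots> \<le> (C * norm (adj UNIV T y)) * norm y"
      using order_trans[OF cmod_cinner_le mult_right_mono[OF C norm_ge_zero]] .
    finally show ?thesis using False by (simp add: power2_eq_square)
  qed
  have "adj UNIV T (x + y) = adj UNIV T x + adj UNIV T y"
    "adj UNIV T (c *\<^sub>C x) = c *\<^sub>C adj UNIV T x" for x y c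
    by (rule cinner_eqI, simp add: a cinner_add_right cinner_scaleC_right)+
  then show ?thesis unfolding bounded_op_def using bd by blast
qed

section \<open>Closures, ranges and kernels as closed subspaces\<close>

lemma closed_csubspace_closure:
  fixes S :: "'a::chilbert_space set"
  assumes "0 \<in> S" and add: "\<And>x y. x \<in> S \<Longrightarrow> y \<in> S \<Longrightarrow> x + y \<in> S"
    and sc: "\<And>c x. x \<in> S \<Longrightarrow> c *\<^sub>C x \<in> S"
  shows "closed_csubspace (closure S)"
proof -
  have "x + y \<in> closure S" if "x \<in> closure S" "y \<in> closure S" for x y
  proof -
    from that obtain u v where "\<And>n::nat. u n \<in> S" "u \<longlonglongrightarrow> x" "\<And>n::nat. v n \<in> S" "v \<longlonglongrightarrow> y"
      unfolding closure_sequential by blast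
    then show ?thesis unfolding closure_sequential
      by (intro exI[of _ "\<lambda>n. u n + v n"]) (auto intro: tendsto_add add)
  qed
  moreover have "c *\<^sub>C x \<in> closure S" if "x \<in> closure S" for c x
  proof -
    have "bounded_linear ((*\<^sub>C) c :: 'a \<Rightarrow> 'a)"
      by (rule bounded_linear_intro[where K = "cmod c"])
        (auto simp: scaleC_add_right scaleR_scaleC scaleC_scaleC norm_scaleC mult.commute)
    moreover from that obtain u where "\<And>n::nat. u n \<in> S" "u \<longlonglongrightarrow> x"
      unfolding closure_sequential by blast
    ultimately show ?thesis unfolding closure_sequential
      by (intro exI[of _ "\<lambda>n. c *\<^sub>C u n"]) (auto intro: bounded_linear.tendsto sc)
  qed
  ultimately show ?thesis using assms(1) closure_subset[of S] by (auto simp: closed_csubspace_def)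
qed

lemma closed_csubspace_closure_range:
  assumes T: "bounded_op UNIV UNIV T"
  shows "closed_csubspace (closure (range T))"
proof (rule closed_csubspace_closure)
  interpret bounded_linear T using T by (rule bounded_op_imp_bounded_linear)
  show "0 \<in> range T" using zero by (metis rangeI)
  show "x + y \<in> range T" if "x \<in> range T" "y \<in> range T" for x y
    using that by (auto simp flip: add)
  show "c *\<^sub>C x \<in> range T" if "x \<in> range T" for c x
    using that by (auto simp flip: bounded_op_scaleC[OF T])
qed

lemma closed_csubspace_kernel:
  assumes T: "bounded_op UNIV UNIV T"
  shows "closed_csubspace {x. T x = 0}"
proof -
  interpret bounded_linear T using T by (rule bounded_op_imp_bounded_linear)
  have "closed {x. T x = 0}"
    by (intro closed_Collect_eq continuous_on continuous_on_const continuous_on_id)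
  then show ?thesis
    by (simp add: closed_csubspace_def zero add bounded_op_scaleC[OF T] scaleC_zero_right)
qed

section \<open>Partial isometries and their range projections\<close>

text \<open>The adjoint inverts \<open>T\<close> on the orthogonal complement \<open>M\<close> of
  the kernel, and every value of \<open>T\<close> is already attained on \<open>M\<close>.\<close>

lemma partial_isometry_adj:
  fixes T :: "'a::chilbert_space \<Rightarrow> 'b::chilbert_space"
  assumes pi: "partial_isometry T"
  shows "T (adj UNIV T (T h)) = T h"
proof -
  have T: "bounded_op UNIV UNIV T" using pi by (simp add: partial_isometry_def)
  interpret bounded_linear T using T by (rule bounded_op_imp_bounded_linear)
  define M where "M = {x. \<forall>z. T z = 0 \<longrightarrow> cinner z x = 0}"
  have M_add: "x + y \<in> M" and M_sc: "c *\<^sub>C x \<in> M" if "x \<in> M" "y \<in> M" for x y c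
    using that by (auto simp: M_def cinner_add_right cinner_scaleC_right)
  have nrm: "norm (T x) = norm x" if "x \<in> M" for x
  proof -
    have "cinner x z = 0" if "T z = 0" for z
      using \<open>x \<in> M\<close> that by (subst cinner_commute) (simp add: M_def)
    then show ?thesis using pi by (simp add: partial_isometry_def)
  qed
  \<comment> \<open>Polarisation: expand the norms of \<open>x + y\<close> and
    \<open>T x + T y\<close>. The next step gets imaginary parts by replacing \<open>x\<close> with
    \<open>\<i> *\<^sub>C x\<close>.\<close>
  have re: "Re (cinner (T x) (T y)) = Re (cinner x y)" if "x \<in> M" "y \<in> M" for x y
    using nrm[OF M_add[OF that]] norm_add_sq[of x y] norm_add_sq[of "T x" "T y"] nrm[OF that(1)] nrm[OF that(2)]
    by (simp add: add)
  have iso: "cinner (T x) (T y) = cinner x y" if "x \<in> M" "y \<in> M" for x y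
    using re[OF that] re[OF M_sc[OF that, of \<i>] that(2)]
    by (simp add: bounded_op_scaleC[OF T] cinner_scaleC_left complex_eq_iff)
  \<comment> \<open>Subtracting from \<open>x\<close> its projection \<open>k\<close> onto the
    kernel changes neither \<open>T x\<close> nor the inner products with \<open>M\<close>.\<close>
  have dec: "\<exists>n\<in>M. T n = T x \<and> (\<forall>w\<in>M. cinner x w = cinner n w)" for x
  proof -
    obtain k where k: "T k = 0" "\<And>z. T z = 0 \<Longrightarrow> cinner z (x - k) = 0"
      using projection_ex[OF closed_csubspace_kernel[OF T], of x] by blast
    have "cinner k w = 0" if "w \<in> M" for w using that k(1) by (simp add: M_def)
    then show ?thesis using k
      by (intro bexI[of _ "x - k"]) (simp_all add: M_def diff cinner.diff_left)
  qed
  obtain n where n: "n \<in> M" "T n = T h" using dec by blast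
  have "cinner (T z) (T n) = cinner z n" for z
    using dec[of z] n(1) by (metis iso)
  then have "adj UNIV T (T n) = n" by (intro adj_eqI closed_csubspace_UNIV) auto
  then show ?thesis using n by simp
qed

text \<open>Each side is self-adjoint and fixes the common range, so
  \<open>Q\<^sub>1 Q\<^sub>2 = Q\<^sub>2\<close> and \<open>Q\<^sub>2 Q\<^sub>1 = Q\<^sub>1\<close>;
  taking adjoints in one of these identities gives equality.\<close>

lemma partial_isometry_same_range:
  assumes pi: "partial_isometry T\<^sub>1" "partial_isometry T\<^sub>2" and eq: "range T\<^sub>1 = range T\<^sub>2"
  shows "T\<^sub>1 (adj UNIV T\<^sub>1 y) = T\<^sub>2 (adj UNIV T\<^sub>2 y)"
proof (rule cinner_eqI)
  fix z
  define Q\<^sub>1 Q\<^sub>2 where Q: "Q\<^sub>1 y = T\<^sub>1 (adj UNIV T\<^sub>1 y)" "Q\<^sub>2 y = T\<^sub>2 (adj UNIV T\<^sub>2 y)" for y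
  have T: "bounded_op UNIV UNIV T\<^sub>1" "bounded_op UNIV UNIV T\<^sub>2"
    using pi by (simp_all add: partial_isometry_def)
  have sa: "cinner (Q\<^sub>1 u) v = cinner u (Q\<^sub>1 v)" "cinner (Q\<^sub>2 u) v = cinner u (Q\<^sub>2 v)" for u v
    unfolding Q cinner_adj[OF T(1)] cinner_adj[OF T(2)]
    by (simp_all add: cinner_adj_left[OF T(1)] cinner_adj_left[OF T(2)])
  have "Q\<^sub>1 (T\<^sub>1 u) = T\<^sub>1 u" "Q\<^sub>2 (T\<^sub>2 v) = T\<^sub>2 v" for u v
    using partial_isometry_adj pi by (simp_all add: Q)
  then have "Q\<^sub>1 (Q\<^sub>2 u) = Q\<^sub>2 u" "Q\<^sub>2 (Q\<^sub>1 u) = Q\<^sub>1 u" for u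
    using eq unfolding Q by (metis rangeE rangeI)+
  then have "cinner z (Q\<^sub>1 y) = cinner z (Q\<^sub>2 y)" by (metis sa)
  then show "cinner z (T\<^sub>1 (adj UNIV T\<^sub>1 y)) = cinner z (T\<^sub>2 (adj UNIV T\<^sub>2 y))" by (simp add: Q)
qed

section \<open>Douglas' factorisation lemma\<close>

text \<open>A kernel vector is orthogonal to the range of the adjoint, hence to its closure, hence
  here to itself.\<close>

lemma kernel_disjoint_closure_range_adj:
  assumes A: "bounded_op UNIV UNIV A" and v: "v \<in> closure (range (adj UNIV A))" and 0: "A v = 0"
  shows "v = 0"
proof -
  have "closure (range (adj UNIV A)) \<subseteq> {w. cinner w v = 0}"
  proof (rule closure_minimal)
    show "range (adj UNIV A) \<subseteq> {w. cinner w v = 0}"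
      by (auto simp: cinner_adj_left[OF A] 0 cinner.zero_right)
    show "closed {w. cinner w v = 0}"
      by (intro closed_Collect_eq cinner.continuous_on continuous_on_const continuous_on_id)
  qed
  then show ?thesis using v cinner_self_eq_0_iff by blast
qed

lemma kernelI_orthogonal_range_adj:
  assumes A: "bounded_op UNIV UNIV A" and d: "\<And>z. z \<in> closure (range (adj UNIV A)) \<Longrightarrow> cinner z d = 0"
  shows "A d = 0"
proof -
  have "adj UNIV A (A d) \<in> closure (range (adj UNIV A))"
    by (rule subsetD[OF closure_subset]) simp
  then have "cinner (A d) (A d) = 0" using d by (simp flip: cinner_adj_left[OF A])
  then show ?thesis by (simp add: cinner_self_eq_0_iff)
qed

text \<open>The hypothesis makes the map from \<open>adj UNIV A\<^sub>1 y\<close> to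
  \<open>adj UNIV A\<^sub>2 y\<close> isometric; it is extended to the closure by limits.\<close>

lemma douglas_lift:
  assumes A: "bounded_op UNIV UNIV A\<^sub>1" "bounded_op UNIV UNIV A\<^sub>2"
    and eq: "\<And>y. A\<^sub>1 (adj UNIV A\<^sub>1 y) = A\<^sub>2 (adj UNIV A\<^sub>2 y)"
    and x: "x \<in> closure (range (adj UNIV A\<^sub>1))"
  shows "\<exists>v\<in>closure (range (adj UNIV A\<^sub>2)). A\<^sub>2 v = A\<^sub>1 x \<and> norm v = norm x"
proof -
  note B = bounded_op_adj[OF A(1), THEN bounded_op_imp_bounded_linear, THEN bounded_linear.linear]
    bounded_op_adj[OF A(2), THEN bounded_op_imp_bounded_linear, THEN bounded_linear.linear]
  have nrm: "norm (adj UNIV A\<^sub>1 y) = norm (adj UNIV A\<^sub>2 y)" for y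
  proof -
    have "cinner (adj UNIV A\<^sub>1 y) (adj UNIV A\<^sub>1 y) = cinner (adj UNIV A\<^sub>2 y) (adj UNIV A\<^sub>2 y)"
      by (simp add: cinner_adj_left[OF A(1)] cinner_adj_left[OF A(2)] eq)
    then show ?thesis unfolding cinner_self by (simp only: of_real_eq_iff) simp
  qed
  obtain u where u: "\<And>n::nat. u n \<in> range (adj UNIV A\<^sub>1)" "u \<longlonglongrightarrow> x"
    using x unfolding closure_sequential by blast
  have "\<exists>y. u n = adj UNIV A\<^sub>1 y" for n using u(1)[of n] by (rule rangeE) blast
  then obtain y where y: "\<And>n. u n = adj UNIV A\<^sub>1 (y n)" by metis
  define w where "w n = adj UNIV A\<^sub>2 (y n)" for n
  have "norm (w m - w n) = norm (u m - u n)" for m n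
    using nrm[of "y m - y n"]
    by (simp add: w_def y linear_diff[OF B(1)] linear_diff[OF B(2)])
  moreover have "Cauchy u" using u(2) LIMSEQ_imp_Cauchy by blast
  ultimately have "Cauchy w" by (simp add: Cauchy_def dist_norm)
  then obtain v where v: "w \<longlonglongrightarrow> v" using Cauchy_convergent convergent_def by blast
  have "v \<in> closure (range (adj UNIV A\<^sub>2))"
    using v unfolding closure_sequential by (intro exI[of _ w]) (simp add: w_def)
  moreover have "A\<^sub>2 v = A\<^sub>1 x"
  proof (rule LIMSEQ_unique)
    show "(\<lambda>n. A\<^sub>2 (w n)) \<longlonglongrightarrow> A\<^sub>2 v"
      by (intro bounded_linear.tendsto[OF bounded_op_imp_bounded_linear[OF A(2)]] v)
    show "(\<lambda>n. A\<^sub>2 (w n)) \<longlonglongrightarrow> A\<^sub>1 x"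
      using bounded_linear.tendsto[OF bounded_op_imp_bounded_linear[OF A(1)] u(2)]
      by (simp add: y w_def eq)
  qed
  moreover have "norm v = norm x"
    using tendsto_norm[OF v] tendsto_norm[OF u(2)] by (simp add: y w_def nrm LIMSEQ_unique)
  ultimately show ?thesis by blast
qed

text \<open>\<open>V\<close> is determined by \<open>A\<^sub>1 = A\<^sub>2 V\<close> and \<open>range V \<subseteq> G\<^sub>2\<close>, since \<open>A\<^sub>2\<close> is injective on \<open>G\<^sub>2\<close>;
  linearity follows from this uniqueness.\<close>

lemma douglas_partial_isometry:
  fixes A\<^sub>1 :: "'a::chilbert_space \<Rightarrow> 'c::chilbert_space" and A\<^sub>2 :: "'b::chilbert_space \<Rightarrow> 'c"
  assumes A: "bounded_op UNIV UNIV A\<^sub>1" "bounded_op UNIV UNIV A\<^sub>2"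
    and eq: "\<And>y. A\<^sub>1 (adj UNIV A\<^sub>1 y) = A\<^sub>2 (adj UNIV A\<^sub>2 y)"
  obtains V where "partial_isometry V" "\<And>x. A\<^sub>2 (V x) = A\<^sub>1 x"
    "unitary_op (closure (range (adj UNIV A\<^sub>1))) (closure (range (adj UNIV A\<^sub>2))) V"
proof -
  define G\<^sub>1 G\<^sub>2 where G: "G\<^sub>1 = closure (range (adj UNIV A\<^sub>1))" "G\<^sub>2 = closure (range (adj UNIV A\<^sub>2))"
  have sub: "closed_csubspace G\<^sub>1" "closed_csubspace G\<^sub>2"
    unfolding G by (intro closed_csubspace_closure_range bounded_op_adj A)+
  interpret A1: bounded_linear A\<^sub>1 using A(1) by (rule bounded_op_imp_bounded_linear)
  interpret A2: bounded_linear A\<^sub>2 using A(2) by (rule bounded_op_imp_bounded_linear)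
  \<comment> \<open>The witness is the orthogonal projection of \<open>x\<close> onto
    \<open>G\<^sub>1\<close>; the remainder is killed by \<open>A\<^sub>1\<close>.\<close>
  have proj: "\<exists>p\<in>G\<^sub>1. A\<^sub>1 p = A\<^sub>1 x \<and> norm p \<le> norm x \<and> (x \<in> G\<^sub>1 \<longrightarrow> p = x) \<and> cinner p (x - p) = 0" for x
  proof -
    obtain p where p: "p \<in> G\<^sub>1" "\<And>z. z \<in> G\<^sub>1 \<Longrightarrow> cinner z (x - p) = 0"
      using projection_ex[OF sub(1)] by blast
    have "A\<^sub>1 (x - p) = 0" using p(2) by (intro kernelI_orthogonal_range_adj[OF A(1)]) (simp add: G)
    moreover have "(norm x)\<^sup>2 = (norm p)\<^sup>2 + (norm (x - p))\<^sup>2"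
      using norm_add_sq[of p "x - p"] p(2)[OF p(1)] by simp
    then have "norm p \<le> norm x" by (simp add: power2_le_imp_le)
    moreover have "p = x" if "x \<in> G\<^sub>1"
      using p(2)[of "x - p"] closed_csubspaceD(6)[OF sub(1) that p(1)] by (simp add: cinner_self_eq_0_iff)
    ultimately show ?thesis using p by (auto simp: A1.diff)
  qed
  have inj: "v = v'" if "v \<in> G\<^sub>2" "v' \<in> G\<^sub>2" "A\<^sub>2 v = A\<^sub>2 v'" for v v'
    using kernel_disjoint_closure_range_adj[OF A(2), of "v - v'"] closed_csubspaceD(6)[OF sub(2) that(1,2)]
      that(3) by (simp add: G A2.diff)
  have "\<exists>v\<in>G\<^sub>2. A\<^sub>2 v = A\<^sub>1 x" for x
  proof -
    obtain p where "p \<in> G\<^sub>1" "A\<^sub>1 p = A\<^sub>1 x" using proj by blast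
    then show ?thesis using douglas_lift[OF A eq, of p] by (auto simp: G)
  qed
  then obtain V where V: "\<And>x. V x \<in> G\<^sub>2" "\<And>x. A\<^sub>2 (V x) = A\<^sub>1 x" by metis
  have V_eq: "V x = v" if "v \<in> G\<^sub>2" "A\<^sub>2 v = A\<^sub>1 x" for x v
    using inj[OF V(1) that(1)] V(2) that(2) by simp
  have nrm: "norm (V x) = norm x" if "x \<in> G\<^sub>1" for x
    using douglas_lift[OF A eq, of x] that V_eq by (auto simp: G)
  have V_proj: "\<exists>p\<in>G\<^sub>1. V x = V p \<and> norm p \<le> norm x \<and> (x \<in> G\<^sub>1 \<longrightarrow> p = x) \<and> cinner p (x - p) = 0" for x
  proof -
    obtain p where p: "p \<in> G\<^sub>1" "A\<^sub>1 p = A\<^sub>1 x"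
      "norm p \<le> norm x \<and> (x \<in> G\<^sub>1 \<longrightarrow> p = x) \<and> cinner p (x - p) = 0"
      using proj by blast
    then have "V x = V p" using V by (intro V_eq) auto
    with p show ?thesis by blast
  qed
  have V_add: "V (x + y) = V x + V y" for x y
    by (intro V_eq closed_csubspaceD(3)[OF sub(2)] V) (simp add: A2.add A1.add V)
  have V_sc: "V (c *\<^sub>C x) = c *\<^sub>C V x" for c x
    by (intro V_eq closed_csubspaceD(4)[OF sub(2)] V) (simp add: bounded_op_scaleC[OF A(1)] bounded_op_scaleC[OF A(2)] V)
  have V_le: "norm (V x) \<le> 1 * norm x" for x using V_proj[of x] nrm by fastforce
  have bV: "bounded_op UNIV UNIV V" unfolding bounded_op_def using V_add V_sc V_le by blast
  interpret V: bounded_linear V using bV by (rule bounded_op_imp_bounded_linear)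
  have "partial_isometry V" unfolding partial_isometry_def
  proof (intro conjI allI impI bV)
    fix x assume x: "\<forall>z. V z = 0 \<longrightarrow> cinner x z = 0"
    \<comment> \<open>As \<open>V (x - p) = 0\<close>, the vector \<open>x - p\<close> is orthogonal
      to \<open>x\<close> as well as to \<open>p\<close>, so it vanishes and \<open>x\<close> lies
      in \<open>G\<^sub>1\<close>.\<close>
    obtain p where p: "p \<in> G\<^sub>1" "V x = V p" "cinner p (x - p) = 0" using V_proj by blast
    have "cinner x (x - p) = 0" using x p(2) by (simp add: V.diff)
    then have "cinner (x - p) (x - p) = 0" using p(3) by (simp add: cinner.diff_left)
    then have "x = p" by (simp add: cinner_self_eq_0_iff)
    then show "norm (V x) = norm x" using nrm p(1) by simp
  qed
  moreover have "unitary_op G\<^sub>1 G\<^sub>2 V"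
  proof -
    \<comment> \<open>Surjectivity is the lifting lemma with the roles of the two operators
      exchanged.\<close>
    have "\<exists>x\<in>G\<^sub>1. V x = v" if "v \<in> G\<^sub>2" for v
    proof -
      obtain x where "x \<in> G\<^sub>1" "A\<^sub>1 x = A\<^sub>2 v"
        using douglas_lift[OF A(2,1) eq[symmetric], of v] \<open>v \<in> G\<^sub>2\<close> by (auto simp: G)
      moreover from this have "V x = v" using V_eq[OF \<open>v \<in> G\<^sub>2\<close>] by simp
      ultimately show ?thesis by blast
    qed
    then have "V ` G\<^sub>1 = G\<^sub>2" using V(1) by blast
    moreover have "bounded_op G\<^sub>1 G\<^sub>2 V"
      unfolding bounded_op_def using V_add V_sc V_le V(1) by blast
    ultimately show ?thesis using nrm by (simp add: unitary_op_def)
  qed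
  ultimately show ?thesis using V(2) that unfolding G by blast
qed

section \<open>Square-summable families\<close>

lemma l2_eqI: "(\<And>i. Rep_l2 h i = Rep_l2 k i) \<Longrightarrow> h = k"
  by (metis Rep_l2_inject ext)

lemmas Rep_l2_simps = zero_l2.rep_eq plus_l2.rep_eq minus_l2.rep_eq scaleR_l2.rep_eq scaleC_l2.rep_eq

lemma Rep_l2_sum: "Rep_l2 (\<Sum>x\<in>A. u x) i = (\<Sum>x\<in>A. Rep_l2 (u x) i)"
  by (induction A rule: infinite_finite_induct) (simp_all add: Rep_l2_simps)

lemma summable_Rep_l2: "(\<lambda>i. (norm (Rep_l2 h i))\<^sup>2) summable_on UNIV"
  using Rep_l2[of h] by simp

lemma norm_Rep_l2_le: "norm (Rep_l2 h i) \<le> norm h"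
  using l2_L2_set_le[OF summable_Rep_l2, of "{i}" h] by (simp add: norm_l2.rep_eq)

lemma bounded_op_Rep_l2: "bounded_op UNIV UNIV (\<lambda>h. Rep_l2 h i)"
  unfolding bounded_op_def
  by (auto simp: Rep_l2_simps intro!: exI[of _ 1] norm_Rep_l2_le)

lemma bounded_linear_Rep_l2: "bounded_linear (\<lambda>h. Rep_l2 h i)"
  by (rule bounded_op_imp_bounded_linear[OF bounded_op_Rep_l2])

text \<open>Dominated convergence: outside a finite index set the tail of \<open>h\<close> is small
  for all \<open>k\<close> at once, and inside it \<open>u k\<close> is eventually zero.\<close>

lemma l2_dominated_tendsto_0:
  fixes u :: "nat \<Rightarrow> ('i, 'e::chilbert_space) l2"
  assumes dom: "\<And>k i. norm (Rep_l2 (u k) i) \<le> norm (Rep_l2 h i)"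
    and ev: "\<And>i. \<forall>\<^sub>F k in sequentially. Rep_l2 (u k) i = 0"
  shows "u \<longlonglongrightarrow> 0"
proof (rule tendstoI)
  fix e :: real assume e: "0 < e"
  define S where "S = (\<Sum>\<^sub>\<infinity>i. (norm (Rep_l2 h i))\<^sup>2)"
  obtain F where F: "finite F" "dist (\<Sum>i\<in>F. (norm (Rep_l2 h i))\<^sup>2) S \<le> (e / 2)\<^sup>2"
    using infsum_finite_approximation[OF summable_Rep_l2[of h], of "(e / 2)\<^sup>2"] e by (auto simp: S_def)
  have "\<forall>\<^sub>F k in sequentially. \<forall>i\<in>F. Rep_l2 (u k) i = 0"
    using F(1) ev by (intro eventually_ball_finite) auto
  then show "\<forall>\<^sub>F k in sequentially. dist (u k) 0 < e"
  proof eventually_elim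
    case (elim k)
    have "norm (u k) \<le> e / 2" unfolding norm_l2.rep_eq
    proof (rule l2_bound(2))
      fix F' :: "'i set" assume F': "finite F'"
      have "(\<Sum>i\<in>F'. (norm (Rep_l2 (u k) i))\<^sup>2) = (\<Sum>i\<in>F' - F. (norm (Rep_l2 (u k) i))\<^sup>2)"
        using F' elim by (intro sum.mono_neutral_right) auto
      also have "\<dots> \<le> (\<Sum>i\<in>F' - F. (norm (Rep_l2 h i))\<^sup>2)"
        by (intro sum_mono power_mono dom) auto
      also have "\<dots> = (\<Sum>i\<in>F' \<union> F. (norm (Rep_l2 h i))\<^sup>2) - (\<Sum>i\<in>F. (norm (Rep_l2 h i))\<^sup>2)"
        using sum.subset_diff[of F "F' \<union> F" "\<lambda>i. (norm (Rep_l2 h i))\<^sup>2"] F' F(1)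
        by (simp add: Un_Diff)
      also have "(\<Sum>i\<in>F' \<union> F. (norm (Rep_l2 h i))\<^sup>2) \<le> S"
        unfolding S_def using F' F(1) by (intro finite_sum_le_infsum summable_Rep_l2) auto
      finally have "(\<Sum>i\<in>F'. (norm (Rep_l2 (u k) i))\<^sup>2) \<le> (e / 2)\<^sup>2"
        using F(2) by (simp add: dist_real_def)
      then show "L2_set (\<lambda>i. norm (Rep_l2 (u k) i)) F' \<le> e / 2"
        using e unfolding L2_set_def by (intro real_le_lsqrt) (auto intro: sum_nonneg)
    qed
    then show ?case using e by simp
  qed
qed

text \<open>On a Fock space this is the elementary tensor of a basis vector with \<open>x\<close>;
  \<open>single []\<close> embeds the coefficient space as the constants.\<close>

definition single :: "'i \<Rightarrow> 'e::chilbert_space \<Rightarrow> ('i, 'e) l2" where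
  "single i x = Abs_l2 (\<lambda>j. if j = i then x else 0)"

lemma Rep_single: "Rep_l2 (single i x) = (\<lambda>j. if j = i then x else 0)"
proof -
  have "(\<lambda>j. (norm (if j = i then x else 0))\<^sup>2) summable_on {i}" by simp
  also have "?this \<longleftrightarrow> (\<lambda>j. (norm (if j = i then x else 0))\<^sup>2) summable_on UNIV"
    by (rule summable_on_cong_neutral) auto
  finally show ?thesis by (simp add: single_def Abs_l2_inverse)
qed

lemma cinner_single: "cinner (single i x) h = cinner x (Rep_l2 h i)"
proof -
  have "cinner (single i x) h = (\<Sum>\<^sub>\<infinity>j\<in>{i}. cinner x (Rep_l2 h i))"
    unfolding cinner_l2.rep_eq by (rule infsum_cong_neutral) (auto simp: Rep_single cinner.zero_left)
  then show ?thesis by simp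
qed

lemma norm_single: "norm (single i x) = norm x"
proof -
  have "cinner (single i x) (single i x) = cinner x x" by (simp add: cinner_single Rep_single)
  then show ?thesis unfolding cinner_self by (simp only: of_real_eq_iff) simp
qed

lemma bounded_op_single: "bounded_op UNIV UNIV (single i)"
  unfolding bounded_op_def
  by (auto simp: norm_single Rep_single Rep_l2_simps scaleC_zero_right intro!: exI[of _ 1] l2_eqI)

section \<open>Operators on Fock spaces\<close>

lemma finite_words_le: "finite {\<alpha> :: 'n::finite list. length \<alpha> \<le> k}"
  using finite_lists_length_le[of "UNIV :: 'n set" k] by simp

lemma finite_words_eq: "finite {\<alpha> :: 'n::finite list. length \<alpha> = k}"
  using finite_lists_length_eq[of "UNIV :: 'n set" k] by simp

text \<open>The truncations to words of length at most \<open>k\<close> are finite sums, since the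
  alphabet is finite, and they converge to \<open>h\<close>.\<close>

lemma closed_csubspace_contains_fock:
  fixes h :: "('n::finite, 'e::chilbert_space) fock"
  assumes M: "closed_csubspace M" and single: "\<And>\<alpha>. single \<alpha> (Rep_l2 h \<alpha>) \<in> M"
  shows "h \<in> M"
proof -
  define u where "u k = (\<Sum>\<alpha> | length \<alpha> \<le> k. single \<alpha> (Rep_l2 h \<alpha>))" for k
  have Rep_u: "Rep_l2 (u k) \<beta> = (if length \<beta> \<le> k then Rep_l2 h \<beta> else 0)" for k \<beta>
    by (simp add: u_def Rep_l2_sum Rep_single finite_words_le)
  have "(\<lambda>k. u k - h) \<longlonglongrightarrow> 0"
  proof (rule l2_dominated_tendsto_0[of _ h])
    show "norm (Rep_l2 (u k - h) \<beta>) \<le> norm (Rep_l2 h \<beta>)" for k \<beta>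
      by (simp add: Rep_l2_simps Rep_u)
    show "\<forall>\<^sub>F k in sequentially. Rep_l2 (u k - h) \<beta> = 0" for \<beta>
      using eventually_ge_at_top[of "length \<beta>"] by eventually_elim (simp add: Rep_l2_simps Rep_u)
  qed
  then have "u \<longlonglongrightarrow> h" by (rule LIM_zero_cancel)
  moreover have "u k \<in> M" for k unfolding u_def by (intro closed_csubspace_sum M single)
  ultimately show ?thesis using closed_sequentially[OF closed_csubspaceD(1)[OF M]] by blast
qed

lemma closed_csubspace_fock_sub:
  fixes G :: "'e::chilbert_space set"
  assumes G: "closed_csubspace G"
  shows "closed_csubspace (fock_sub G :: ('n, 'e) fock set)"
proof -
  have "(fock_sub G :: ('n, 'e) fock set) = (\<Inter>\<alpha>. (\<lambda>h. Rep_l2 h \<alpha>) -` G)" by (auto simp: fock_sub_def)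
  moreover have "closed ((\<lambda>h. Rep_l2 h \<alpha>) -` G)" for \<alpha> :: "'n list"
    by (intro continuous_closed_vimage closed_csubspaceD[OF G] linear_continuous_at bounded_linear_Rep_l2)
  ultimately have "closed (fock_sub G :: ('n, 'e) fock set)" by (simp add: closed_INT)
  then show ?thesis using closed_csubspaceD[OF G]
    by (simp add: closed_csubspace_def fock_sub_def Rep_l2_simps)
qed

section \<open>The universal model and its words\<close>

lemma admissibleD:
  assumes "admissible b"
  shows "0 < b \<alpha>" "b [] = 1" "bdd_above (range (\<lambda>\<alpha>. b \<alpha> / b (i # \<alpha>)))"
proof -
  note a = assms[unfolded admissible_def]
  show "0 < b \<alpha>" using a by blast
  show "b [] = 1" using a by blast
  show "bdd_above (range (\<lambda>\<alpha>. b \<alpha> / b (i # \<alpha>)))"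
    by (rule a[THEN conjunct2, THEN conjunct2, THEN conjunct1, THEN spec])
qed

lemma Rep_model:
  assumes "admissible b"
  shows "Rep_l2 (model b i h) = (\<lambda>\<alpha>. case \<alpha> of [] \<Rightarrow> 0
    | j # \<beta> \<Rightarrow> if j = i then sqrt (b \<beta> / b (i # \<beta>)) *\<^sub>R Rep_l2 h \<beta> else 0)"
  by (rule ext)
    (simp add: model_def Rep_creation Rep_weight_op[OF admissibleD(1,3)[OF assms]] split: list.split)

lemma norm_creation: "norm (creation i h) = norm h"
proof -
  have "(\<Sum>\<^sub>\<infinity>\<alpha>. (norm (Rep_l2 (creation i h) \<alpha>))\<^sup>2)
      = (\<Sum>\<^sub>\<infinity>\<alpha>\<in>range ((#) i). (norm (Rep_l2 (creation i h) \<alpha>))\<^sup>2)"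
    by (rule infsum_cong_neutral) (auto simp: Rep_creation split: list.splits)
  also have "\<dots> = (\<Sum>\<^sub>\<infinity>\<alpha>. (norm (Rep_l2 h \<alpha>))\<^sup>2)"
    by (subst infsum_reindex) (auto simp: o_def Rep_creation)
  finally show ?thesis by (simp add: norm_l2.rep_eq)
qed

lemma norm_weight_op_le:
  assumes b: "admissible b" and C: "\<And>\<alpha>. b \<alpha> / b (i # \<alpha>) \<le> C"
  shows "norm (weight_op b i h) \<le> sqrt C * norm h"
proof -
  note Rep = Rep_weight_op[OF admissibleD(1,3)[OF b]]
  have le: "(norm (Rep_l2 (weight_op b i h) \<alpha>))\<^sup>2 \<le> C * (norm (Rep_l2 h \<alpha>))\<^sup>2" for \<alpha>
  proof -
    have "0 \<le> b \<alpha> / b (i # \<alpha>)" using admissibleD(1)[OF b] by (simp add: less_imp_le)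
    then show ?thesis
      using mult_right_mono[OF C[of \<alpha>], of "(norm (Rep_l2 h \<alpha>))\<^sup>2"]
      by (simp add: Rep power_mult_distrib del: real_sqrt_divide)
  qed
  have "(\<Sum>\<^sub>\<infinity>\<alpha>. (norm (Rep_l2 (weight_op b i h) \<alpha>))\<^sup>2) \<le> (\<Sum>\<^sub>\<infinity>\<alpha>. C * (norm (Rep_l2 h \<alpha>))\<^sup>2)"
    by (intro infsum_mono le summable_Rep_l2 summable_on_cmult_right)
  also have "\<dots> = C * (\<Sum>\<^sub>\<infinity>\<alpha>. (norm (Rep_l2 h \<alpha>))\<^sup>2)" by (rule infsum_cmult_right')
  finally show ?thesis by (simp add: norm_l2.rep_eq flip: real_sqrt_mult)
qed

lemma bounded_op_model:
  assumes b: "admissible b"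
  shows "bounded_op UNIV UNIV (model b i)"
proof -
  obtain C where C: "b \<alpha> / b (i # \<alpha>) \<le> C" for \<alpha>
    using admissibleD(3)[OF b, of i] by (auto simp: bdd_above_def)
  have "norm (model b i h) \<le> sqrt C * norm h" for h :: "('a, 'b) fock"
    using norm_weight_op_le[where C = C, OF b C] by (simp add: model_def norm_creation)
  moreover have "model b i (h + k) = model b i h + model b i k" for h k :: "('a, 'b) fock"
    by (rule l2_eqI) (auto simp: Rep_model[OF b] Rep_l2_simps scaleR_add_right split: list.splits)
  moreover have "model b i (c *\<^sub>C h) = c *\<^sub>C model b i h" for c and h :: "('a, 'b) fock"
    by (rule l2_eqI)
      (auto simp: Rep_model[OF b] Rep_l2_simps scaleC_zero_right scaleR_scaleC scaleC_scaleC mult.commute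
        split: list.splits)
  ultimately show ?thesis unfolding bounded_op_def by blast
qed

lemma bounded_op_word_op:
  assumes "\<And>i. bounded_op UNIV UNIV (X i)"
  shows "bounded_op UNIV UNIV (word_op X \<alpha>)"
proof (induction \<alpha>)
  case Nil
  show ?case by (auto simp: bounded_op_def intro: exI[of _ 1])
next
  case (Cons i \<alpha>)
  then show ?case using bounded_op_compose[OF assms Cons] by (simp add: comp_def)
qed

lemma adj_compose:
  assumes "bounded_op UNIV UNIV S" "bounded_op UNIV UNIV T"
  shows "adj UNIV (S \<circ> T) y = adj UNIV T (adj UNIV S y)"
  by (rule adj_eqI) (simp_all add: closed_csubspace_UNIV cinner_adj assms)

text \<open>Prepending the letters of \<alpha> multiplies weights that telescope, leaving
  \<open>b\<close> only at the two end words.\<close>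

lemma Rep_word_model:
  assumes b: "admissible b"
  shows "Rep_l2 (word_op (model b) \<alpha> h) \<beta> = (if take (length \<alpha>) \<beta> = \<alpha>
    then sqrt (b (drop (length \<alpha>) \<beta>) / b \<beta>) *\<^sub>R Rep_l2 h (drop (length \<alpha>) \<beta>) else 0)"
proof (induction \<alpha> arbitrary: \<beta>)
  case Nil
  show ?case using admissibleD(1)[OF b, of \<beta>] by simp
next
  case (Cons i \<alpha>)
  have "sqrt (b \<gamma> / b \<delta>) * sqrt (b \<epsilon> / b \<gamma>) = sqrt (b \<epsilon> / b \<delta>)" for \<gamma> \<delta> \<epsilon>
    using admissibleD(1)[OF b, of \<gamma>] by (simp flip: real_sqrt_mult)
  then show ?case using Cons by (auto simp: Rep_model[OF b] split: list.splits simp del: real_sqrt_divide)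
qed

lemma word_model_single:
  assumes b: "admissible b"
  shows "word_op (model b) \<alpha> (single \<gamma> x) = sqrt (b \<gamma> / b (\<alpha> @ \<gamma>)) *\<^sub>R single (\<alpha> @ \<gamma>) x"
proof (rule l2_eqI)
  have "take (length \<alpha>) \<beta> = \<alpha> \<and> drop (length \<alpha>) \<beta> = \<gamma> \<longleftrightarrow> \<beta> = \<alpha> @ \<gamma>" for \<beta>
    by (metis append_eq_conv_conj append_take_drop_id)
  then show "Rep_l2 (word_op (model b) \<alpha> (single \<gamma> x)) \<beta>
      = Rep_l2 (sqrt (b \<gamma> / b (\<alpha> @ \<gamma>)) *\<^sub>R single (\<alpha> @ \<gamma>) x) \<beta>" for \<beta>
    by (auto simp: Rep_word_model[OF b] Rep_single Rep_l2_simps)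
qed

text \<open>Coefficients are read off by pairing with \<open>single \<gamma> x\<close>, whose image
  under the word operator is again a multiple of a single tensor.\<close>

lemma Rep_adj_word_model:
  assumes b: "admissible b"
  shows "Rep_l2 (adj UNIV (word_op (model b) \<alpha>) h) \<gamma> = sqrt (b \<gamma> / b (\<alpha> @ \<gamma>)) *\<^sub>R Rep_l2 h (\<alpha> @ \<gamma>)"
proof (rule cinner_eqI)
  fix x
  have "cinner x (Rep_l2 (adj UNIV (word_op (model b) \<alpha>) h) \<gamma>)
      = cinner (word_op (model b) \<alpha> (single \<gamma> x)) h"
    by (simp add: cinner_adj[OF bounded_op_word_op[OF bounded_op_model[OF b]]] cinner_single)
  then show "cinner x (Rep_l2 (adj UNIV (word_op (model b) \<alpha>) h) \<gamma>)
      = cinner x (sqrt (b \<gamma> / b (\<alpha> @ \<gamma>)) *\<^sub>R Rep_l2 h (\<alpha> @ \<gamma>))"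
    by (simp add: word_model_single[OF b] cinner.scaleR_left cinner.scaleR_right cinner_single
        del: real_sqrt_divide)
qed

lemma Rep_adj_model:
  assumes b: "admissible b"
  shows "Rep_l2 (adj UNIV (model b i) h) \<gamma> = sqrt (b \<gamma> / b (i # \<gamma>)) *\<^sub>R Rep_l2 h (i # \<gamma>)"
  using Rep_adj_word_model[OF b, of "[i]" h \<gamma>] by simp

section \<open>The defect operator of the model\<close>

text \<open>Each product of a word operator with its adjoint is diagonal and lives on the words with
  prefix \<alpha>.\<close>

lemma Rep_defect_partial_model:
  fixes h :: "('n::finite, 'e::chilbert_space) fock"
  assumes b: "admissible b"
  shows "Rep_l2 (defect_partial b UNIV (model b) k h) \<beta> =
    (\<Sum>p\<le>k. if p \<le> length \<beta> then nc_inverse b (take p \<beta>) * b (drop p \<beta>) / b \<beta> else 0) *\<^sub>R Rep_l2 h \<beta>"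
proof -
  have "Rep_l2 (word_op (model b) \<alpha> (adj UNIV (word_op (model b) \<alpha>) h)) \<beta>
      = (if take (length \<alpha>) \<beta> = \<alpha> then (b (drop (length \<alpha>) \<beta>) / b \<beta>) *\<^sub>R Rep_l2 h \<beta> else 0)" for \<alpha>
  proof -
    have "\<alpha> @ drop (length \<alpha>) \<beta> = \<beta>" if "take (length \<alpha>) \<beta> = \<alpha>"
      using that by (metis append_take_drop_id)
    moreover have "sqrt (b (drop (length \<alpha>) \<beta>) / b \<beta>) * sqrt (b (drop (length \<alpha>) \<beta>) / b \<beta>)
        = b (drop (length \<alpha>) \<beta>) / b \<beta>"
      using admissibleD(1)[OF b] by (simp add: less_imp_le del: real_sqrt_divide)
    ultimately show ?thesis
      by (simp add: Rep_word_model[OF b] Rep_adj_word_model[OF b] del: real_sqrt_divide)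
  qed
  then have "Rep_l2 (defect_partial b UNIV (model b) k h) \<beta> = (\<Sum>p\<le>k. \<Sum>\<alpha> | length \<alpha> = p.
      if take p \<beta> = \<alpha> then (nc_inverse b \<alpha> * b (drop p \<beta>) / b \<beta>) *\<^sub>R Rep_l2 h \<beta> else 0)"
    unfolding defect_partial_def Rep_l2_sum scaleR_l2.rep_eq
    by (intro sum.cong) (auto simp del: sum.delta sum.delta')
  \<comment> \<open>Only \<alpha> = \<open>take p \<beta>\<close> contributes in degree
    \<open>p\<close>; beyond the length of \<beta> this prefix is shorter than \<open>p\<close>, so
    nothing does.\<close>
  also have "\<dots> = (\<Sum>p\<le>k. (if p \<le> length \<beta> then nc_inverse b (take p \<beta>) * b (drop p \<beta>) / b \<beta> else 0)
      *\<^sub>R Rep_l2 h \<beta>)"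
    by (intro sum.cong) (auto simp: finite_words_eq sum.delta' min_def)
  finally show ?thesis by (simp add: scaleR_sum_left)
qed

text \<open>For a regular domain the diagonal entries decrease in \<open>k\<close> from \<open>1\<close> to their final value,
  which is \<open>(g\<^sup>-\<^sup>1 g)\<^sub>\<beta> / b\<^sub>\<beta>\<close>; this makes them uniformly bounded.\<close>

lemma defect_partial_model_tendsto:
  fixes h :: "('n::finite, 'e::chilbert_space) fock"
  assumes b: "admissible b" and reg: "regular_domain b"
  shows "(\<lambda>k. defect_partial b UNIV (model b) k h) \<longlonglongrightarrow> single [] (Rep_l2 h [])"
proof -
  \<comment> \<open>\<open>t \<beta> p\<close> is the contribution of degree \<open>p\<close> to the
    diagonal entry at \<beta>, and \<open>c k \<beta>\<close> is the entry of the partial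
    sum.\<close>
  define t where "t \<beta> p = (if p \<le> length \<beta> then nc_inverse b (take p \<beta>) * b (drop p \<beta>) / b \<beta> else 0)" for \<beta> p
  define c where "c k \<beta> = (\<Sum>p\<le>k. t \<beta> p)" for k \<beta>
  note inv = nc_inverse[of b, OF admissibleD(2)[OF b]]
  have "nc_inverse b [] = 1"
    using fun_cong[OF inv(2), of "[]"] by (simp add: nc_mult_Nil nc_one_def admissibleD(2)[OF b])
  then have c_0: "c 0 \<beta> = 1" for \<beta> using admissibleD(1)[OF b, of \<beta>] by (simp add: c_def t_def)
  have t_le: "t \<beta> p \<le> 0" if "1 \<le> p" for \<beta> p
  proof (cases "p \<le> length \<beta>")
    case True
    then have "nc_inverse b (take p \<beta>) \<le> 0" using that reg by (simp add: regular_domain_def)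
    moreover have "0 \<le> b (drop p \<beta>) / b \<beta>" using admissibleD(1)[OF b] by (simp add: less_imp_le)
    ultimately show ?thesis using mult_nonpos_nonneg[of _ "b (drop p \<beta>) / b \<beta>"] by (simp add: t_def)
  qed (simp add: t_def)
  have c_final: "c k \<beta> = nc_one \<beta>" if "length \<beta> \<le> k" for k \<beta>
  proof -
    have "c k \<beta> = (\<Sum>p\<le>length \<beta>. t \<beta> p)"
      unfolding c_def using that by (intro sum.mono_neutral_right) (auto simp: t_def)
    also have "\<dots> = nc_mult (nc_inverse b) b \<beta> / b \<beta>"
      by (simp add: nc_mult_def t_def sum_divide_distrib)
    also have "\<dots> = nc_one \<beta>" unfolding inv by (simp add: nc_one_def admissibleD(2)[OF b])
    finally show ?thesis .
  qed
  have c_antimono: "c l \<beta> \<le> c k \<beta>" if "k \<le> l" for k l \<beta>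
    using that
  proof (induction rule: dec_induct)
    case (step m)
    then show ?case using t_le[of "Suc m" \<beta>] by (simp add: c_def)
  qed simp
  \<comment> \<open>Monotonicity is compared with index 0 and with an index past the length of
    \<beta>, where the final value is reached.\<close>
  have "c k \<beta> \<le> 1" "nc_one \<beta> \<le> c k \<beta>" for k \<beta>
    using c_antimono[of 0 k \<beta>] c_antimono[of k "max k (length \<beta>)" \<beta>] by (simp_all add: c_0 c_final)
  moreover have "0 \<le> (nc_one \<beta> :: real)" for \<beta> :: "'n list" by (simp add: nc_one_def)
  ultimately have bd: "\<bar>c k \<beta> - nc_one \<beta>\<bar> \<le> 1" for k \<beta> by (smt (verit))
  have Rep: "Rep_l2 (defect_partial b UNIV (model b) k h - single [] (Rep_l2 h [])) \<beta>
      = (c k \<beta> - nc_one \<beta>) *\<^sub>R Rep_l2 h \<beta>" for k \<beta>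
    by (simp add: Rep_l2_simps Rep_defect_partial_model[OF b] Rep_single c_def t_def nc_one_def
        scaleR_diff_left)
  have "(\<lambda>k. defect_partial b UNIV (model b) k h - single [] (Rep_l2 h [])) \<longlonglongrightarrow> 0"
  proof (rule l2_dominated_tendsto_0[of _ h])
    show "norm (Rep_l2 (defect_partial b UNIV (model b) k h - single [] (Rep_l2 h [])) \<beta>)
        \<le> norm (Rep_l2 h \<beta>)" for k \<beta>
      unfolding Rep using mult_right_mono[OF bd norm_ge_zero] by simp
    show "\<forall>\<^sub>F k in sequentially.
        Rep_l2 (defect_partial b UNIV (model b) k h - single [] (Rep_l2 h [])) \<beta> = 0" for \<beta>
      unfolding Rep using eventually_ge_at_top[of "length \<beta>"] by eventually_elim (simp add: c_final)
  qed
  then show ?thesis by (rule LIM_zero_cancel)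
qed

section \<open>Amplifications and multi-analytic operators\<close>

lemma Rep_ampl:
  assumes V: "bounded_op UNIV UNIV V"
  shows "Rep_l2 (ampl V h) \<alpha> = V (Rep_l2 h \<alpha>)"
proof -
  obtain C where C: "norm (V x) \<le> C * norm x" for x using V unfolding bounded_op_def by blast
  have "(\<lambda>\<alpha>. C\<^sup>2 * (norm (Rep_l2 h \<alpha>))\<^sup>2) summable_on UNIV"
    by (intro summable_on_cmult_right summable_Rep_l2)
  then have "(\<lambda>\<alpha>. (norm (V (Rep_l2 h \<alpha>)))\<^sup>2) summable_on UNIV"
    by (rule summable_on_comparison_test)
      (use power_mono[OF C norm_ge_zero, of _ 2] in \<open>auto simp: power_mult_distrib\<close>)
  then show ?thesis by (simp add: ampl_def Abs_l2_inverse)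
qed

lemma norm_ampl_le:
  assumes V: "bounded_op UNIV UNIV V" and C: "\<And>x. norm (V x) \<le> C * norm x" "0 \<le> C"
  shows "norm (ampl V h) \<le> C * norm h"
  unfolding norm_l2.rep_eq
proof (rule l2_bound(2))
  fix F :: "'c list set" assume F: "finite F"
  have "L2_set (\<lambda>\<alpha>. norm (Rep_l2 (ampl V h) \<alpha>)) F \<le> L2_set (\<lambda>\<alpha>. C * norm (Rep_l2 h \<alpha>)) F"
    by (rule L2_set_mono) (simp_all add: Rep_ampl[OF V] C)
  also have "\<dots> = C * L2_set (\<lambda>\<alpha>. norm (Rep_l2 h \<alpha>)) F"
    using C(2) by (simp add: L2_set_right_distrib)
  also have "\<dots> \<le> C * sqrt (\<Sum>\<^sub>\<infinity>\<alpha>. (norm (Rep_l2 h \<alpha>))\<^sup>2)"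
    by (intro mult_left_mono l2_L2_set_le summable_Rep_l2 F C)
  finally show "L2_set (\<lambda>\<alpha>. norm (Rep_l2 (ampl V h) \<alpha>)) F
    \<le> C * sqrt (\<Sum>\<^sub>\<infinity>\<alpha>. (norm (Rep_l2 h \<alpha>))\<^sup>2)" .
qed

lemma bounded_op_ampl:
  assumes V: "bounded_op UNIV UNIV V"
  shows "bounded_op UNIV UNIV (ampl V)"
proof -
  obtain C where C: "0 \<le> C" "\<And>x. norm (V x) \<le> C * norm x"
    using bounded_linear.nonneg_bounded[OF bounded_op_imp_bounded_linear[OF V]] by (metis mult.commute)
  interpret bounded_linear V using V by (rule bounded_op_imp_bounded_linear)
  have "ampl V (x + y) = ampl V x + ampl V y" "ampl V (c *\<^sub>C x) = c *\<^sub>C ampl V x" for x y c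
    by (rule l2_eqI, simp add: Rep_ampl[OF V] Rep_l2_simps add bounded_op_scaleC[OF V])+
  then show ?thesis unfolding bounded_op_def using norm_ampl_le[OF V C(2,1)] by blast
qed

lemma ampl_single:
  assumes V: "bounded_op UNIV UNIV V"
  shows "ampl V (single \<alpha> x) = single \<alpha> (V x)"
proof -
  interpret bounded_linear V using V by (rule bounded_op_imp_bounded_linear)
  show ?thesis by (rule l2_eqI) (simp add: Rep_ampl[OF V] Rep_single zero)
qed

text \<open>The amplification acts on coefficients and the model on words, so they commute.\<close>

lemma multi_analytic_comp_ampl:
  assumes g: "admissible g" and \<Psi>: "multi_analytic g f \<Psi>" and V: "bounded_op UNIV UNIV V"
  shows "multi_analytic g f (\<Psi> \<circ> ampl V)"
proof -
  interpret bounded_linear V using V by (rule bounded_op_imp_bounded_linear)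
  have "ampl V (model g i h) = model g i (ampl V h)" for i h
    by (rule l2_eqI) (auto simp: Rep_ampl[OF V] Rep_model[OF g] zero scaleR split: list.split)
  moreover have "bounded_op UNIV UNIV (\<lambda>h. \<Psi> (ampl V h))"
    using \<Psi> by (intro bounded_op_compose[OF _ bounded_op_ampl[OF V]]) (simp add: multi_analytic_def)
  ultimately show ?thesis using \<Psi> by (simp add: multi_analytic_def comp_def)
qed

lemma multi_analytic_word_op:
  assumes "multi_analytic g f \<Psi>"
  shows "\<Psi> (word_op (model g) \<alpha> h) = word_op (model f) \<alpha> (\<Psi> h)"
  using assms by (induction \<alpha>) (simp_all add: multi_analytic_def)

text \<open>This is the adjoint of the intertwining relation for words.\<close>

lemma multi_analytic_adj_word_op:
  assumes f: "admissible f" and g: "admissible g" and \<Psi>: "multi_analytic g f \<Psi>"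
  shows "adj UNIV \<Psi> (adj UNIV (word_op (model f) \<alpha>) y) = adj UNIV (word_op (model g) \<alpha>) (adj UNIV \<Psi> y)"
proof -
  have b: "bounded_op UNIV UNIV \<Psi>" using \<Psi> by (simp add: multi_analytic_def)
  note w = bounded_op_word_op[OF bounded_op_model]
  have "word_op (model f) \<alpha> \<circ> \<Psi> = \<Psi> \<circ> word_op (model g) \<alpha>"
    by (rule ext) (simp add: multi_analytic_word_op[OF \<Psi>])
  then show ?thesis by (simp flip: adj_compose[OF w[OF f] b] adj_compose[OF b w[OF g]])
qed

text \<open>Used to reach every elementary tensor from the constants by model words.\<close>

lemma single_eq_word_model:
  assumes b: "admissible b"
  shows "single \<alpha> x = sqrt (b \<alpha>) *\<^sub>R word_op (model b) \<alpha> (single [] x)"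
  using admissibleD(1)[OF b, of \<alpha>]
  by (simp add: word_model_single[OF b] admissibleD(2)[OF b] real_sqrt_divide)

text \<open>The kernel of the difference is a closed subspace; by intertwining it contains every
  elementary tensor once it contains the constants.\<close>

lemma multi_analytic_eqI:
  fixes \<Psi> \<Phi> :: "('n::finite, 'e::chilbert_space) fock \<Rightarrow> ('n, 'k::chilbert_space) fock"
  assumes g: "admissible g" and \<Psi>: "multi_analytic g f \<Psi>" and \<Phi>: "multi_analytic g f \<Phi>"
    and eq: "\<And>x. \<Psi> (single [] x) = \<Phi> (single [] x)"
  shows "\<Psi> = \<Phi>"
proof (rule ext)
  fix h
  have b: "bounded_op UNIV UNIV \<Psi>" "bounded_op UNIV UNIV \<Phi>"
    using \<Psi> \<Phi> by (simp_all add: multi_analytic_def)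
  interpret P: bounded_linear \<Psi> using b(1) by (rule bounded_op_imp_bounded_linear)
  interpret Q: bounded_linear \<Phi> using b(2) by (rule bounded_op_imp_bounded_linear)
  have "\<Psi> (c *\<^sub>C u) - \<Phi> (c *\<^sub>C u) = c *\<^sub>C (\<Psi> u - \<Phi> u)" for c u
    using scaleC_add_right[of c "\<Psi> u - \<Phi> u" "\<Phi> u"]
    by (simp add: bounded_op_scaleC[OF b(1)] bounded_op_scaleC[OF b(2)])
  then have "bounded_op UNIV UNIV (\<lambda>h. \<Psi> h - \<Phi> h)"
    by (intro bounded_opI bounded_linear_sub P.bounded_linear_axioms Q.bounded_linear_axioms)
  then have "closed_csubspace {h. \<Psi> h - \<Phi> h = 0}" by (rule closed_csubspace_kernel)
  moreover have "\<Psi> (single \<alpha> x) = \<Phi> (single \<alpha> x)" for \<alpha> x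
    by (simp add: single_eq_word_model[OF g, of \<alpha>] P.scaleR Q.scaleR
        multi_analytic_word_op[OF \<Psi>] multi_analytic_word_op[OF \<Phi>] eq)
  ultimately have "h \<in> {h. \<Psi> h - \<Phi> h = 0}" by - (rule closed_csubspace_contains_fock, simp_all)
  then show "\<Psi> h = \<Phi> h" by simp
qed

text \<open>For the empty word this identifies the adjoint of the restriction to constants with the
  constant coefficient of \<open>adj UNIV \<Psi>\<close>.\<close>

lemma adj_multi_analytic_single:
  assumes "bounded_op UNIV UNIV \<Psi>"
  shows "adj UNIV (\<lambda>x. \<Psi> (single \<alpha> x)) y = Rep_l2 (adj UNIV \<Psi> y) \<alpha>"
  by (rule adj_eqI) (simp_all add: closed_csubspace_UNIV cinner_adj[OF assms] cinner_single)

section \<open>Supports\<close>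

lemma reducing_fock_sub:
  assumes g: "admissible g" and G: "closed_csubspace G"
  shows "reducing g (fock_sub G)"
  unfolding reducing_def
  using closed_csubspace_fock_sub[OF G] closed_csubspaceD[OF G]
  by (auto simp: fock_sub_def Rep_model[OF g] Rep_adj_model[OF g] split: list.split)

lemma reducing_word_op:
  assumes g: "admissible g" and M: "reducing g M" and h: "h \<in> M"
  shows "word_op (model g) \<alpha> h \<in> M" "adj UNIV (word_op (model g) \<alpha>) h \<in> M"
proof -
  show "word_op (model g) \<alpha> h \<in> M"
    using h M by (induction \<alpha>) (auto simp: reducing_def)
  show "adj UNIV (word_op (model g) \<alpha>) h \<in> M"
    using h
  proof (induction \<alpha> arbitrary: h)
    case Nil
    then show ?case using adj_eqI[OF closed_csubspace_UNIV, of h "\<lambda>x. x" h] by (simp add: id_def)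
  next
    case (Cons i \<alpha>)
    \<comment> \<open>Adjoints reverse composition: the first letter acts first, so the induction
      must generalise \<open>h\<close>.\<close>
    have "adj UNIV (model g i) h \<in> M" using Cons.prems M unfolding reducing_def by blast
    from Cons.IH[OF this] show ?case
      unfolding word_op.simps
        adj_compose[OF bounded_op_model[OF g] bounded_op_word_op[OF bounded_op_model[OF g]]] .
  qed
qed

lemma supp_eq_fock_sub:
  fixes \<Psi> :: "('n::finite, 'e::chilbert_space) fock \<Rightarrow> ('n, 'k::chilbert_space) fock"
  assumes f: "admissible f" and g: "admissible g" and reg: "regular_domain g"
    and \<Psi>: "multi_analytic g f \<Psi>"
  defines "G \<equiv> closure (range (adj UNIV (\<lambda>x. \<Psi> (single [] x))))"
  shows "supp g \<Psi> = fock_sub G" "closed_csubspace G"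
proof -
  have b: "bounded_op UNIV UNIV \<Psi>" using \<Psi> by (simp add: multi_analytic_def)
  show G: "closed_csubspace G" unfolding G_def
    by (intro closed_csubspace_closure_range bounded_op_adj bounded_op_compose[OF b bounded_op_single])
  have in_G: "Rep_l2 (adj UNIV \<Psi> y) [] \<in> G" for y
    unfolding G_def adj_multi_analytic_single[OF b, symmetric]
    by (rule subsetD[OF closure_subset]) simp
  have "range (adj UNIV \<Psi>) \<subseteq> fock_sub G"
  proof -
    have "Rep_l2 (adj UNIV \<Psi> y) \<alpha> \<in> G" for y \<alpha>
    proof -
      \<comment> \<open>The \<alpha>-coefficient of \<open>adj UNIV \<Psi> y\<close> is a multiple
        of the constant coefficient at another vector, because \<open>adj UNIV \<Psi>\<close>
        intertwines the adjoint words.\<close>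
      have "sqrt (g \<alpha>) *\<^sub>R Rep_l2 (adj UNIV \<Psi> (adj UNIV (word_op (model f) \<alpha>) y)) [] \<in> G"
        by (intro closed_csubspaceD[OF G] in_G)
      then show ?thesis
        using admissibleD(1)[OF g, of \<alpha>]
        by (simp add: multi_analytic_adj_word_op[OF f g \<Psi>] Rep_adj_word_model[OF g]
            admissibleD(2)[OF g] real_sqrt_divide)
    qed
    then show ?thesis by (auto simp: fock_sub_def)
  qed
  then have "closure (range (adj UNIV \<Psi>)) \<subseteq> fock_sub G"
    by (intro closure_minimal closed_csubspaceD[OF closed_csubspace_fock_sub[OF G]])
  then have le: "supp g \<Psi> \<subseteq> fock_sub G"
    unfolding supp_def using reducing_fock_sub[OF g G] by blast
  have "fock_sub G \<subseteq> M" if M: "reducing g M" "closure (range (adj UNIV \<Psi>)) \<subseteq> M" for M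
  proof -
    have sub: "closed_csubspace M" using M(1) by (simp add: reducing_def)
    \<comment> \<open>A reducing subspace is stable under the partial defects, and closedness passes
      this to their limit, the projection onto constants.\<close>
    have "single [] (Rep_l2 (adj UNIV \<Psi> y) []) \<in> M" for y
    proof (rule closed_sequentially)
      have "adj UNIV \<Psi> y \<in> M" using M(2) closure_subset by blast
      then show "defect_partial g UNIV (model g) k (adj UNIV \<Psi> y) \<in> M" for k
        unfolding defect_partial_def
        by (intro closed_csubspace_sum closed_csubspaceD[OF sub] sub reducing_word_op[OF g M(1)])
    qed (rule closed_csubspaceD[OF sub] defect_partial_model_tendsto[OF g reg])+
    moreover have "closed (single [] -` M)"
      by (intro continuous_closed_vimage closed_csubspaceD[OF sub] linear_continuous_at
          bounded_op_imp_bounded_linear[OF bounded_op_single])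
    ultimately have "G \<subseteq> single [] -` M"
      unfolding G_def by (intro closure_minimal) (auto simp: adj_multi_analytic_single[OF b])
    \<comment> \<open>Model words carry the constants with values in \<open>G\<close> to all
      elementary tensors of \<open>fock_sub G\<close>.\<close>
    then have "single \<alpha> x \<in> M" if "x \<in> G" for \<alpha> x
      unfolding single_eq_word_model[OF g, of \<alpha>] using that
      by (intro closed_csubspaceD[OF sub] reducing_word_op[OF g M(1)]) auto
    then show ?thesis
      using closed_csubspace_contains_fock[OF sub] by (simp add: fock_sub_def subset_iff)
  qed
  then have "fock_sub G \<subseteq> supp g \<Psi>" unfolding supp_def by blast
  with le show "supp g \<Psi> = fock_sub G" by blast
qed

section \<open>Uniqueness\<close>

lemma multi_analytic_wandering_eq:
  fixes \<Psi>\<^sub>1 :: "('n::finite, 'e1::chilbert_space) fock \<Rightarrow> ('n, 'k::chilbert_space) fock"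
    and \<Psi>\<^sub>2 :: "('n, 'e2::chilbert_space) fock \<Rightarrow> ('n, 'k) fock"
  assumes f: "admissible f" and g: "admissible g" and reg: "regular_domain g"
    and \<Psi>: "multi_analytic g f \<Psi>\<^sub>1" "multi_analytic g f \<Psi>\<^sub>2"
    and eq: "\<And>y. \<Psi>\<^sub>1 (adj UNIV \<Psi>\<^sub>1 y) = \<Psi>\<^sub>2 (adj UNIV \<Psi>\<^sub>2 y)"
  shows "\<Psi>\<^sub>1 (single [] (Rep_l2 (adj UNIV \<Psi>\<^sub>1 y) [])) = \<Psi>\<^sub>2 (single [] (Rep_l2 (adj UNIV \<Psi>\<^sub>2 y) []))"
proof -
  \<comment> \<open>Both intertwining relations move the word operators outward, leaving \<Psi> next
    to its adjoint; by \<open>eq\<close> the resulting sums agree for the two operators.\<close>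
  have conj: "\<Psi> (defect_partial g UNIV (model g) k (adj UNIV \<Psi> y)) = (\<Sum>p\<le>k. \<Sum>\<alpha> | length \<alpha> = p.
      nc_inverse g \<alpha> *\<^sub>R word_op (model f) \<alpha> (\<Psi> (adj UNIV \<Psi> (adj UNIV (word_op (model f) \<alpha>) y))))"
    if \<Psi>: "multi_analytic g f \<Psi>" for k and \<Psi> :: "('n, 'e::chilbert_space) fock \<Rightarrow> ('n, 'k) fock"
  proof -
    interpret bounded_linear \<Psi>
      using \<Psi> by (intro bounded_op_imp_bounded_linear) (simp add: multi_analytic_def)
    show ?thesis
      by (simp add: defect_partial_def sum scaleR multi_analytic_word_op[OF \<Psi>]
          multi_analytic_adj_word_op[OF f g \<Psi>])
  qed
  have lim: "(\<lambda>k. \<Psi> (defect_partial g UNIV (model g) k (adj UNIV \<Psi> y)))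
      \<longlonglongrightarrow> \<Psi> (single [] (Rep_l2 (adj UNIV \<Psi> y) []))"
    if "multi_analytic g f \<Psi>" for \<Psi> :: "('n, 'e::chilbert_space) fock \<Rightarrow> ('n, 'k) fock"
    by (rule bounded_linear.tendsto[OF bounded_op_imp_bounded_linear defect_partial_model_tendsto[OF g reg]])
      (use that in \<open>simp add: multi_analytic_def\<close>)
  show ?thesis
    using lim[OF \<Psi>(1)] lim[OF \<Psi>(2)] unfolding conj[OF \<Psi>(1)] conj[OF \<Psi>(2)] eq by (rule LIMSEQ_unique)
qed

theorem corollary2p11:
  fixes f g :: "'n::finite list \<Rightarrow> real"
    and \<Psi>\<^sub>1 :: "('n, 'e1::chilbert_space) fock \<Rightarrow> ('n, 'k::chilbert_space) fock"
    and \<Psi>\<^sub>2 :: "('n, 'e2::chilbert_space) fock \<Rightarrow> ('n, 'k) fock"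
  assumes "admissible f" and "admissible g"
    and "regular_domain g"
    and "\<And>H :: ('i::infinite, complex) l2 set.
           closed_csubspace H \<Longrightarrow> pure_domain f H \<subseteq> pure_domain g H"
    and "multi_analytic g f \<Psi>\<^sub>1" and "partial_isometry \<Psi>\<^sub>1"
    and "multi_analytic g f \<Psi>\<^sub>2" and "partial_isometry \<Psi>\<^sub>2"
    and "range \<Psi>\<^sub>1 = range \<Psi>\<^sub>2"
  shows "(\<exists>V :: 'e1 \<Rightarrow> 'e2. partial_isometry V \<and> \<Psi>\<^sub>1 = \<Psi>\<^sub>2 \<circ> ampl V)
    \<and> (\<exists>G\<^sub>1 G\<^sub>2. closed_csubspace G\<^sub>1 \<and> closed_csubspace G\<^sub>2
         \<and> supp g \<Psi>\<^sub>1 = fock_sub G\<^sub>1 \<and> supp g \<Psi>\<^sub>2 = fock_sub G\<^sub>2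
         \<and> coincide G\<^sub>1 \<Psi>\<^sub>1 G\<^sub>2 \<Psi>\<^sub>2)"
proof -
  note f = assms(1) and g = assms(2) and reg = assms(3) and \<Psi>\<^sub>1 = assms(5) and \<Psi>\<^sub>2 = assms(7)
  define A\<^sub>1 A\<^sub>2 where A: "A\<^sub>1 = (\<lambda>x. \<Psi>\<^sub>1 (single [] x))" "A\<^sub>2 = (\<lambda>x. \<Psi>\<^sub>2 (single [] x))"
  have b: "bounded_op UNIV UNIV \<Psi>\<^sub>1" "bounded_op UNIV UNIV \<Psi>\<^sub>2"
    using \<Psi>\<^sub>1 \<Psi>\<^sub>2 by (simp_all add: multi_analytic_def)
  have bA: "bounded_op UNIV UNIV A\<^sub>1" "bounded_op UNIV UNIV A\<^sub>2"
    unfolding A by (intro b[THEN bounded_op_compose[OF _ bounded_op_single]])+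
  have "\<Psi>\<^sub>1 (adj UNIV \<Psi>\<^sub>1 y) = \<Psi>\<^sub>2 (adj UNIV \<Psi>\<^sub>2 y)" for y
    using assms(6,8,9) by (rule partial_isometry_same_range)
  from multi_analytic_wandering_eq[OF f g reg \<Psi>\<^sub>1 \<Psi>\<^sub>2 this]
  have "A\<^sub>1 (adj UNIV A\<^sub>1 y) = A\<^sub>2 (adj UNIV A\<^sub>2 y)" for y
    by (simp add: A adj_multi_analytic_single[OF b(1)] adj_multi_analytic_single[OF b(2)])
  then obtain V where V: "partial_isometry V" "\<And>x. A\<^sub>2 (V x) = A\<^sub>1 x"
    "unitary_op (closure (range (adj UNIV A\<^sub>1))) (closure (range (adj UNIV A\<^sub>2))) V"
    using douglas_partial_isometry[OF bA] by blast
  have bV: "bounded_op UNIV UNIV V" using V(1) by (simp add: partial_isometry_def)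
  have eq: "\<Psi>\<^sub>1 = \<Psi>\<^sub>2 \<circ> ampl V"
    \<comment> \<open>Both sides are multi-analytic, so \<open>A\<^sub>2 (V x) = A\<^sub>1 x\<close>
      on constants suffices.\<close>
    using V(2) by (intro multi_analytic_eqI[OF g \<Psi>\<^sub>1 multi_analytic_comp_ampl[OF g \<Psi>\<^sub>2 bV]])
      (simp add: ampl_single[OF bV] A)
  \<comment> \<open>The same \<open>V\<close> serves as the unitary between the coefficient spaces
    of the two supports.\<close>
  then have "coincide (closure (range (adj UNIV A\<^sub>1))) \<Psi>\<^sub>1 (closure (range (adj UNIV A\<^sub>2))) \<Psi>\<^sub>2"
    using V(3) unfolding coincide_def by (metis comp_apply)
  moreover note supp_eq_fock_sub[OF f g reg \<Psi>\<^sub>1] supp_eq_fock_sub[OF f g reg \<Psi>\<^sub>2]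
  ultimately show ?thesis using V(1) eq unfolding A by blast
qed

end
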